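(* Let $\Phi=(A;\{E_i\}_{i=0}^d;A^*;\{E^*_i\}_{i=0}^d)$ be a sharp tridiagonal system on $V$ with eigenvalue sequence $\{\theta_i\}_{i=0}^d$, dual eigenvalue sequence $\{\theta^*_i\}_{i=0}^d$ and split sequence $\{\zeta_i\}_{i=0}^d$. Let $\{\zeta_i^{\downarrow}\}_{i=0}^d$, $\{\zeta_i^{\Downarrow}\}_{i=0}^d$, $\{\zeta_i^{\downarrow\Downarrow}\}_{i=0}^d$ denote the split sequences of $\Phi^{\downarrow}$, $\Phi^{\Downarrow}$, $\Phi^{\downarrow\Downarrow}$ respectively. Then (i)--(iv) hold. (i) For $0\le i\le d$ both $$\frac{\zeta_i^{\downarrow}}{(\theta_0-\theta_1)(\theta_0-\theta_2)\cdots(\theta_0-\theta_i)}=\sum_{h=0}^i\frac{[h,i-h,d-i]_q\,\eta^*_{i-h}(\theta^*_0)\,\zeta_h}{(\theta_0-\theta_1)(\theta_0-\theta_2)\cdots(\theta_0-\theta_h)},$$ $$\frac{\zeta_i}{(\theta_0-\theta_1)(\theta_0-\theta_2)\cdots(\theta_0-\theta_i)}=\sum_{h=0}^i\frac{[h,i-h,d-i]_q\,\tau^*_{i-h}(\theta^*_d)\,\zeta_h^{\downarrow}}{(\theta_0-\theta_1)(\theta_0-\theta_2)\cdots(\theta_0-\theta_h)}.$$ (ii) For $0\le i\le d$ both $$\frac{\zeta_i^{\Downarrow}}{(\theta^*_0-\theta^*_1)(\theta^*_0-\theta^*_2)\cdots(\theta^*_0-\theta^*_i)}=\sum_{h=0}^i\frac{[h,i-h,d-i]_q\,\eta_{i-h}(\theta_0)\,\zeta_h}{(\theta^*_0-\theta^*_1)(\theta^*_0-\theta^*_2)\cdots(\theta^*_0-\theta^*_h)},$$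 $$\frac{\zeta_i}{(\theta^*_0-\theta^*_1)(\theta^*_0-\theta^*_2)\cdots(\theta^*_0-\theta^*_i)}=\sum_{h=0}^i\frac{[h,i-h,d-i]_q\,\tau_{i-h}(\theta_d)\,\zeta_h^{\Downarrow}}{(\theta^*_0-\theta^*_1)(\theta^*_0-\theta^*_2)\cdots(\theta^*_0-\theta^*_h)}.$$ (iii) For $0\le i\le d$ both $$\frac{\zeta_i^{\downarrow\Downarrow}}{(\theta^*_d-\theta^*_{d-1})(\theta^*_d-\theta^*_{d-2})\cdots(\theta^*_d-\theta^*_{d-i})}=\sum_{h=0}^i\frac{[h,i-h,d-i]_q\,\eta_{i-h}(\theta_0)\,\zeta_h^{\downarrow}}{(\theta^*_d-\theta^*_{d-1})(\theta^*_d-\theta^*_{d-2})\cdots(\theta^*_d-\theta^*_{d-h})},$$ $$\frac{\zeta_i^{\downarrow}}{(\theta^*_d-\theta^*_{d-1})(\theta^*_d-\theta^*_{d-2})\cdots(\theta^*_d-\theta^*_{d-i})}=\sum_{h=0}^i\frac{[h,i-h,d-i]_q\,\tau_{i-h}(\theta_d)\,\zeta_h^{\downarrow\Downarrow}}{(\theta^*_d-\theta^*_{d-1})(\theta^*_d-\theta^*_{d-2})\cdots(\theta^*_d-\theta^*_{d-h})}.$$ (iv) For $0\le i\le d$ both $$\frac{\zeta_i^{\downarrow\Downarrow}}{(\theta_d-\theta_{d-1})(\theta_d-\theta_{d-2})\cdots(\theta_d-\theta_{d-i})}=\sum_{h=0}^i\frac{[h,i-h,d-i]_q\,\eta^*_{i-h}(\theta^*_0)\,\zeta_h^{\Downarrow}}{(\theta_d-\theta_{d-1})(\theta_d-\theta_{d-2})\cdots(\theta_d-\theta_{d-h})},$$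 $$\frac{\zeta_i^{\Downarrow}}{(\theta_d-\theta_{d-1})(\theta_d-\theta_{d-2})\cdots(\theta_d-\theta_{d-i})}=\sum_{h=0}^i\frac{[h,i-h,d-i]_q\,\tau^*_{i-h}(\theta^*_d)\,\zeta_h^{\downarrow\Downarrow}}{(\theta_d-\theta_{d-1})(\theta_d-\theta_{d-2})\cdots(\theta_d-\theta_{d-h})}.$$
   Context: $\mathbb{K}$ is a field and $V$ is a $\mathbb{K}$-vector space of finite positive dimension; $\mathrm{End}(V)$ is the algebra of $\mathbb{K}$-linear maps $V\to V$, with identity $I$. "Diagonalizable" means $V$ is spanned by the eigenspaces. A tridiagonal pair on $V$ is an ordered pair $A,A^*\in\mathrm{End}(V)$ ($A^*$ is just a name, not an adjoint) such that: (i) each of $A,A^*$ is diagonalizable; (ii) there is an ordering $\{V_i\}_{i=0}^d$ of the eigenspaces of $A$ with $A^*V_i\subseteq V_{i-1}+V_i+V_{i+1}$ for $0\le i\le d$ (where $V_{-1}=V_{d+1}=0$); (iii) there is an ordering $\{V^*_i\}_{i=0}^\delta$ of the eigenspaces of $A^*$ with $AV^*_i\subseteq V^*_{i-1}+V^*_i+V^*_{i+1}$ for $0\le i\le\delta$ (where $V^*_{-1}=V^*_{\delta+1}=0$); (iv) no subspace $W$ with $0\ne W\ne V$ satisfies $AW\subseteq W$ and $A^*W\subseteq W$. Orderings as in (ii), (iii) are called standard. It is known that $d=\delta$ and that $V_i,V_{d-i},V^*_i,V^*_{d-i}$ all have the same dimension for $0\le i\le d$. A tridiagonal system on $V$ is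 a sequence $\Phi=(A;\{E_i\}_{i=0}^d;A^*;\{E^*_i\}_{i=0}^d)$ where $A,A^*$ is a tridiagonal pair on $V$ and $\{E_i\}$ (resp. $\{E^*_i\}$) are the primitive idempotents (projections onto the eigenspaces along the other eigenspaces) of $A$ (resp. $A^*$), ordered so that the eigenspaces $\{E_iV\}$ (resp. $\{E^*_iV\}$) are in a standard order. $\theta_i$ (resp. $\theta^*_i$) is the eigenvalue of $A$ (resp. $A^*$) on $E_iV$ (resp. $E^*_iV$); $\{\theta_i\}$ and $\{\theta_i^*\}$ are the eigenvalue sequence and dual eigenvalue sequence of $\Phi$. $\Phi$ is sharp if $\dim E_0V=1$ (equivalently $\dim E^*_0V=1$). For an indeterminate $\lambda$ and $0\le i\le d$: $\tau_i=(\lambda-\theta_0)(\lambda-\theta_1)\cdots(\lambda-\theta_{i-1})$, $\eta_i=(\lambda-\theta_d)(\lambda-\theta_{d-1})\cdots(\lambda-\theta_{d-i+1})$, $\tau^*_i=(\lambda-\theta^*_0)(\lambda-\theta^*_1)\cdots(\lambda-\theta^*_{i-1})$, $\eta^*_i=(\lambda-\theta^*_d)(\lambda-\theta^*_{d-1})\cdots(\lambda-\theta^*_{d-i+1})$. Split sequence: let $U_i=(E^*_0V+\cdots+E^*_iV)\cap(E_iV+\cdots+E_dV)$ for $0\le i\le d$. It is known that $V=U_0+\cdots+U_d$ is a direct sum, $U_0=E_0^*V$, $(A-\theta_iI)U_i\subseteq U_{i+1}$ and $(A^*-\theta^*_iI)U_i\subseteq U_{i-1}$ ($U_{-1}=U_{d+1}=0$).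 If $\Phi$ is sharp, $\dim U_0=1$ and $U_0$ is invariant under $(A^*-\theta^*_1I)(A^*-\theta^*_2I)\cdots(A^*-\theta^*_iI)(A-\theta_{i-1}I)\cdots(A-\theta_1I)(A-\theta_0I)$; the corresponding eigenvalue is $\zeta_i$, and $\{\zeta_i\}_{i=0}^d$ is the split sequence of $\Phi$. Relatives used: $\Phi^{\downarrow}=(A;\{E_i\};A^*;\{E^*_{d-i}\})$, $\Phi^{\Downarrow}=(A;\{E_{d-i}\};A^*;\{E^*_i\})$, $\Phi^{\downarrow\Downarrow}=(A;\{E_{d-i}\};A^*;\{E^*_{d-i}\})$ (indices $0\le i\le d$); these are sharp tridiagonal systems on $V$, and their split sequences are obtained by applying the definition to them. The scalars $[r,s,t]_q$: it is known that for $2\le i\le d-1$ the expressions $\frac{\theta_{i-2}-\theta_{i+1}}{\theta_{i-1}-\theta_i}$ and $\frac{\theta^*_{i-2}-\theta^*_{i+1}}{\theta^*_{i-1}-\theta^*_i}$ are equal and independent of $i$. Let $q$ be a nonzero scalar in the algebraic closure of $\mathbb{K}$ with $q+q^{-1}+1$ equal to this common value (for $d\ge 3$). For nonnegative integers $r,s,t$ with $r+s+t\le d$ the scalar $[r,s,t]_q\in\mathbb{K}$ is defined as follows. - If $q\ne1$, $q\ne-1$: $[r,s,t]_q=\dfrac{(q;q)_{r+s}(q;q)_{r+t}(q;q)_{s+t}}{(q;q)_r(q;q)_s(q;q)_t(q;q)_{r+s+t}}$, where $(a;q)_n=(1-a)(1-aq)\cdots(1-aq^{n-1})$. - If $q=1$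 and $\mathrm{Char}(\mathbb{K})\ne2$: $[r,s,t]_q=\dfrac{(r+s)!\,(r+t)!\,(s+t)!}{r!\,s!\,t!\,(r+s+t)!}$. - If $q=-1$ and $\mathrm{Char}(\mathbb{K})\ne2$: $[r,s,t]_q=0$ if $r,s,t$ are all odd, and otherwise $[r,s,t]_q=\dfrac{\lfloor\frac{r+s}{2}\rfloor!\,\lfloor\frac{r+t}{2}\rfloor!\,\lfloor\frac{s+t}{2}\rfloor!}{\lfloor\frac r2\rfloor!\,\lfloor\frac s2\rfloor!\,\lfloor\frac t2\rfloor!\,\lfloor\frac{r+s+t}{2}\rfloor!}$. - If $q=1$ and $\mathrm{Char}(\mathbb{K})=2$ (in which case necessarily $d\le3$): $[r,s,t]_q=0$ if $r=s=t=1$, and $[r,s,t]_q=1$ otherwise. In all cases the denominators are nonzero for $r+s+t\le d$. If $d\le2$, then at least one of $r,s,t$ is zero and $[r,s,t]_q=1$. *)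

theory Defs
  imports "HOL-Algebra.Algebraic_Closure_Type"
begin

section \<open>Tridiagonal systems\<close>

locale pos_fin_dim_vector_space = finite_dimensional_vector_space +
  assumes dim_pos: "dim UNIV > 0"
begin

definition eigenspace :: "('b \<Rightarrow> 'b) \<Rightarrow> 'a \<Rightarrow> 'b set" where
  "eigenspace A c = {v. A v = c *s v}"

definition eigenvalue :: "('b \<Rightarrow> 'b) \<Rightarrow> 'a \<Rightarrow> bool" where
  "eigenvalue A c \<longleftrightarrow> (\<exists>v. v \<noteq> 0 \<and> A v = c *s v)"

definition eigenspaces :: "('b \<Rightarrow> 'b) \<Rightarrow> 'b set set" where
  "eigenspaces A = {eigenspace A c | c. eigenvalue A c}"

definition diagonalizable :: "('b \<Rightarrow> 'b) \<Rightarrow> bool" where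
  "diagonalizable A \<longleftrightarrow> span (\<Union>(eigenspaces A)) = UNIV"

text \<open>A sum of subspaces is rendered as the span of their union; dropping the out-of-range
  indices amounts to the convention that the spaces with index \<open>-1\<close> and \<open>d + 1\<close> are zero.\<close>

definition standard_ordering ::
    "nat \<Rightarrow> ('b \<Rightarrow> 'b) \<Rightarrow> ('b \<Rightarrow> 'b) \<Rightarrow> (nat \<Rightarrow> 'b set) \<Rightarrow> bool" where
  "standard_ordering d A B W \<longleftrightarrow>
     bij_betw W {..d} (eigenspaces A) \<and>
     (\<forall>i\<le>d. B ` W i \<subseteq> span (\<Union>j\<in>{j. j \<le> d \<and> i \<le> j + 1 \<and> j \<le> i + 1}. W j))"

definition tridiagonal_pair :: "('b \<Rightarrow> 'b) \<Rightarrow> ('b \<Rightarrow> 'b) \<Rightarrow> bool" where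
  "tridiagonal_pair A As \<longleftrightarrow>
     Vector_Spaces.linear scale scale A \<and> Vector_Spaces.linear scale scale As \<and>
     diagonalizable A \<and> diagonalizable As \<and>
     (\<exists>d W. standard_ordering d A As W) \<and>
     (\<exists>\<delta> W. standard_ordering \<delta> As A W) \<and>
     \<not> (\<exists>W. subspace W \<and> W \<noteq> {0} \<and> W \<noteq> UNIV \<and> A ` W \<subseteq> W \<and> As ` W \<subseteq> W)"

text \<open>The projection onto an eigenspace along the sum of the other ones.\<close>

definition primitive_idempotent :: "('b \<Rightarrow> 'b) \<Rightarrow> ('b \<Rightarrow> 'b) \<Rightarrow> bool" where
  "primitive_idempotent A P \<longleftrightarrow>
     Vector_Spaces.linear scale scale P \<and>
     (\<exists>c. eigenvalue A c \<and> (\<forall>v\<in>eigenspace A c. P v = v) \<and>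
          (\<forall>c'. c' \<noteq> c \<longrightarrow> (\<forall>v\<in>eigenspace A c'. P v = 0)))"

text \<open>A sequence indexed by \<open>0, \<dots>, d\<close> is a function on \<open>nat\<close>; its values beyond \<open>d\<close> are
  irrelevant.\<close>

definition tridiagonal_system ::
    "nat \<Rightarrow> ('b \<Rightarrow> 'b) \<Rightarrow> (nat \<Rightarrow> 'b \<Rightarrow> 'b) \<Rightarrow> ('b \<Rightarrow> 'b) \<Rightarrow> (nat \<Rightarrow> 'b \<Rightarrow> 'b) \<Rightarrow> bool" where
  "tridiagonal_system d A E As Es \<longleftrightarrow>
     tridiagonal_pair A As \<and>
     (\<forall>i\<le>d. primitive_idempotent A (E i)) \<and>
     (\<forall>i\<le>d. primitive_idempotent As (Es i)) \<and>
     standard_ordering d A As (\<lambda>i. range (E i)) \<and>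
     standard_ordering d As A (\<lambda>i. range (Es i))"

definition sharp_tridiagonal_system ::
    "nat \<Rightarrow> ('b \<Rightarrow> 'b) \<Rightarrow> (nat \<Rightarrow> 'b \<Rightarrow> 'b) \<Rightarrow> ('b \<Rightarrow> 'b) \<Rightarrow> (nat \<Rightarrow> 'b \<Rightarrow> 'b) \<Rightarrow> bool" where
  "sharp_tridiagonal_system d A E As Es \<longleftrightarrow>
     tridiagonal_system d A E As Es \<and> dim (range (E 0)) = 1"

definition eigenvalue_on :: "('b \<Rightarrow> 'b) \<Rightarrow> 'b set \<Rightarrow> 'a" where
  "eigenvalue_on A W = (THE c. \<forall>v\<in>W. A v = c *s v)"

definition eigenvalue_seq :: "('b \<Rightarrow> 'b) \<Rightarrow> (nat \<Rightarrow> 'b \<Rightarrow> 'b) \<Rightarrow> nat \<Rightarrow> 'a" where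
  "eigenvalue_seq A E i = eigenvalue_on A (range (E i))"

subsection \<open>The split sequence\<close>

definition split_space :: "nat \<Rightarrow> (nat \<Rightarrow> 'b \<Rightarrow> 'b) \<Rightarrow> (nat \<Rightarrow> 'b \<Rightarrow> 'b) \<Rightarrow> nat \<Rightarrow> 'b set" where
  "split_space d E Es i =
     span (\<Union>j\<in>{0..i}. range (Es j)) \<inter> span (\<Union>j\<in>{i..d}. range (E j))"

text \<open>\<open>raise_prod A \<theta> i\<close> is \<open>(A - \<theta> (i - 1) I) \<cdots> (A - \<theta> 1 I) (A - \<theta> 0 I)\<close>, and
  \<open>lower_prod B \<theta> i\<close> is \<open>(B - \<theta> 1 I) (B - \<theta> 2 I) \<cdots> (B - \<theta> i I)\<close>.\<close>

primrec raise_prod :: "('b \<Rightarrow> 'b) \<Rightarrow> (nat \<Rightarrow> 'a) \<Rightarrow> nat \<Rightarrow> 'b \<Rightarrow> 'b" where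
  "raise_prod A \<theta> 0 = id"
| "raise_prod A \<theta> (Suc i) = (\<lambda>v. A v - \<theta> i *s v) \<circ> raise_prod A \<theta> i"

primrec lower_prod :: "('b \<Rightarrow> 'b) \<Rightarrow> (nat \<Rightarrow> 'a) \<Rightarrow> nat \<Rightarrow> 'b \<Rightarrow> 'b" where
  "lower_prod B \<theta> 0 = id"
| "lower_prod B \<theta> (Suc i) = lower_prod B \<theta> i \<circ> (\<lambda>v. B v - \<theta> (Suc i) *s v)"

definition split_seq ::
    "nat \<Rightarrow> ('b \<Rightarrow> 'b) \<Rightarrow> (nat \<Rightarrow> 'b \<Rightarrow> 'b) \<Rightarrow> ('b \<Rightarrow> 'b) \<Rightarrow> (nat \<Rightarrow> 'b \<Rightarrow> 'b) \<Rightarrow> nat \<Rightarrow> 'a" where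
  "split_seq d A E As Es i =
     eigenvalue_on
       (lower_prod As (eigenvalue_seq As Es) i \<circ> raise_prod A (eigenvalue_seq A E) i)
       (split_space d E Es 0)"

end

section \<open>The polynomials attached to an eigenvalue sequence\<close>

definition tau_poly :: "(nat \<Rightarrow> 'k::field) \<Rightarrow> nat \<Rightarrow> 'k Polynomial.poly" where
  "tau_poly \<theta> i = (\<Prod>j<i. [:- \<theta> j, 1:])"

definition eta_poly :: "nat \<Rightarrow> (nat \<Rightarrow> 'k::field) \<Rightarrow> nat \<Rightarrow> 'k Polynomial.poly" where
  "eta_poly d \<theta> i = (\<Prod>j<i. [:- \<theta> (d - j), 1:])"

section \<open>The scalars \<open>[r, s, t]\<^sub>q\<close>\<close>

text \<open>For \<open>d \<ge> 3\<close>, the common value of the listed ratios, which for the eigenvalue and dual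
  eigenvalue sequences of a tridiagonal system all agree.\<close>

definition common_ratio :: "nat \<Rightarrow> (nat \<Rightarrow> 'k::field) \<Rightarrow> (nat \<Rightarrow> 'k) \<Rightarrow> 'k" where
  "common_ratio d \<theta> \<theta>s = (THE c. \<forall>i\<in>{2..d - 1}.
      (\<theta> (i - 2) - \<theta> (i + 1)) / (\<theta> (i - 1) - \<theta> i) = c \<and>
      (\<theta>s (i - 2) - \<theta>s (i + 1)) / (\<theta>s (i - 1) - \<theta>s i) = c)"

definition qpochhammer :: "'a::comm_ring_1 \<Rightarrow> 'a \<Rightarrow> nat \<Rightarrow> 'a" where
  "qpochhammer a q n = (\<Prod>k<n. 1 - a * q ^ k)"

definition qfrac :: "'a::field \<Rightarrow> nat \<Rightarrow> nat \<Rightarrow> nat \<Rightarrow> 'a" where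
  "qfrac q r s t =
     (qpochhammer q q (r + s) * qpochhammer q q (r + t) * qpochhammer q q (s + t)) /
     (qpochhammer q q r * qpochhammer q q s * qpochhammer q q t * qpochhammer q q (r + s + t))"

text \<open>In the generic case the quotient is formed in the algebraic closure and pulled back to
  the base field; \<open>qfrac_in_base_field\<close> below shows that it lies there whenever
  \<open>q + 1 / q\<close> does. In characteristic 2, \<open>q = 1\<close> and \<open>q = -1\<close> coincide.\<close>

definition qbracket :: "'k::field alg_closure \<Rightarrow> nat \<Rightarrow> nat \<Rightarrow> nat \<Rightarrow> 'k" where
  "qbracket q r s t =
     (if q \<noteq> 1 \<and> q \<noteq> -1 then of_ac (qfrac q r s t)
      else if CHAR('k) = 2 then (if r = 1 \<and> s = 1 \<and> t = 1 then 0 else 1)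
      else if q = 1 then
        of_nat (fact (r + s) * fact (r + t) * fact (s + t)) /
        of_nat (fact r * fact s * fact t * fact (r + s + t))
      else if odd r \<and> odd s \<and> odd t then 0
      else
        of_nat (fact ((r + s) div 2) * fact ((r + t) div 2) * fact ((s + t) div 2)) /
        of_nat (fact (r div 2) * fact (s div 2) * fact (t div 2) * fact ((r + s + t) div 2)))"

lemma qpochhammer_inverse:
  fixes q :: "'a::field"
  assumes "q \<noteq> 0"
  shows "qpochhammer (inverse q) (inverse q) n =
    (-1) ^ n * inverse q ^ (n * (n + 1) div 2) * qpochhammer q q n"
proof (induction n)
  case 0
  then show ?case by (simp add: qpochhammer_def)
next
  case (Suc n)
  have e: "Suc n * (Suc n + 1) div 2 = n * (n + 1) div 2 + Suc n"
    by simp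
  have f: "1 - inverse q * inverse q ^ n = - (inverse q ^ Suc n * (1 - q * q ^ n))"
    using assms by (simp add: field_simps)
  have "qpochhammer (inverse q) (inverse q) (Suc n) =
      qpochhammer (inverse q) (inverse q) n * (1 - inverse q * inverse q ^ n)"
    by (simp add: qpochhammer_def)
  also have "\<dots> = (-1) ^ Suc n * (inverse q ^ (n * (n + 1) div 2) * inverse q ^ Suc n) *
      (qpochhammer q q n * (1 - q * q ^ n))"
    unfolding Suc.IH f by (simp add: mult_ac)
  also have "\<dots> = (-1) ^ Suc n * inverse q ^ (Suc n * (Suc n + 1) div 2) * qpochhammer q q (Suc n)"
    unfolding e power_add by (simp add: qpochhammer_def)
  finally show ?case .
qed

lemma qfrac_inverse:
  fixes q :: "'a::field"
  assumes q: "q \<noteq> 0"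
  shows "qfrac (inverse q) r s t = qfrac q r s t"
proof -
  define T where "T n = n * (n + 1) div 2" for n :: nat
  define c where "c n = (-1) ^ n * inverse q ^ T n" for n :: nat
  have T2: "2 * T n = n * (n + 1)" for n
    unfolding T_def by simp
  have "2 * (T (r + s) + T (r + t) + T (s + t)) = 2 * (T r + T s + T t + T (r + s + t))"
    unfolding distrib_left T2 by (simp add: algebra_simps)
  hence T: "T (r + s) + T (r + t) + T (s + t) = T r + T s + T t + T (r + s + t)"
    by simp
  have neg: "(-1::'a) ^ (r + s) * (-1) ^ (r + t) * (-1) ^ (s + t) =
      (-1) ^ r * (-1) ^ s * (-1) ^ t * (-1) ^ (r + s + t)"
    by (simp add: power_add mult_ac)
  have "c (r + s) * c (r + t) * c (s + t) =
      ((-1) ^ (r + s) * (-1) ^ (r + t) * (-1) ^ (s + t)) *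
      inverse q ^ (T (r + s) + T (r + t) + T (s + t))"
    unfolding c_def power_add[of "inverse q"] by (simp only: mult_ac)
  also have "\<dots> = c r * c s * c t * c (r + s + t)"
    unfolding c_def neg T power_add[of "inverse q"] by (simp only: mult_ac)
  finally have c: "c (r + s) * c (r + t) * c (s + t) = c r * c s * c t * c (r + s + t)" .
  have nz: "c n \<noteq> 0" for n
    using q by (simp add: c_def)
  have p: "qpochhammer (inverse q) (inverse q) n = c n * qpochhammer q q n" for n
    using qpochhammer_inverse[OF q] by (simp add: c_def T_def)
  have "qfrac (inverse q) r s t =
      ((c (r + s) * c (r + t) * c (s + t)) *
       (qpochhammer q q (r + s) * qpochhammer q q (r + t) * qpochhammer q q (s + t))) /
      ((c r * c s * c t * c (r + s + t)) *
       (qpochhammer q q r * qpochhammer q q s * qpochhammer q q t * qpochhammer q q (r + s + t)))"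
    unfolding qfrac_def p by (simp only: mult_ac)
  also have "\<dots> = qfrac q r s t"
    unfolding c qfrac_def by (rule mult_divide_mult_cancel_left) (simp add: nz)
  finally show ?thesis .
qed

lemma qfrac_in_base_field:
  fixes q :: "'k::field alg_closure"
  assumes q: "q \<noteq> 0" and b: "q + inverse q \<in> range to_ac"
  shows "qfrac q r s t \<in> range to_ac"
proof -
  have closed: "x + y \<in> range to_ac" "x - y \<in> range to_ac" "x * y \<in> range to_ac"
      "x / y \<in> range to_ac"
    if "x \<in> range to_ac" "y \<in> range to_ac" for x y :: "'k alg_closure"
    using that by (auto simp flip: to_ac_add to_ac_diff to_ac_mult to_ac_divide)
  have one: "1 \<in> range (to_ac :: 'k \<Rightarrow> _)"
    by (metis rangeI to_ac_1)
  show ?thesis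
  proof (cases "q \<in> range to_ac")
    case True
    have "q ^ n \<in> range to_ac" for n
      by (induction n) (use True one closed in auto)
    hence "qpochhammer q q n \<in> range to_ac" for n
      by (induction n) (use True one closed in \<open>auto simp: qpochhammer_def\<close>)
    thus ?thesis
      unfolding qfrac_def by (intro closed)
  next
    case False
    obtain \<beta> where \<beta>: "q + inverse q = to_ac \<beta>"
      using b by auto
    have q2: "inverse q = to_ac \<beta> - q"
      using \<beta> by (simp add: algebra_simps)
    have qq: "q * q = to_ac \<beta> * q - 1"
      using q by (simp add: \<beta>[symmetric] distrib_right)
    define R where "R z z' \<longleftrightarrow>
      (\<exists>x y. z = to_ac x + to_ac y * q \<and> z' = to_ac x + to_ac y * inverse q)" for z z'
    have RI: "R z z'"
      if "z = to_ac x + to_ac y * q" "z' = to_ac x + to_ac y * inverse q" for x y z z'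
      using that unfolding R_def by blast
    have R1: "R 1 1"
      by (rule RI[of _ 1 0]) auto
    have Rq: "R q (inverse q)"
      by (rule RI[of _ 0 1]) auto
    have Rdiff: "R (z - w) (z' - w')" if "R z z'" "R w w'" for z z' w w'
    proof -
      from that obtain x y u v where
        "z = to_ac x + to_ac y * q" "z' = to_ac x + to_ac y * inverse q"
        "w = to_ac u + to_ac v * q" "w' = to_ac u + to_ac v * inverse q"
        unfolding R_def by blast
      thus ?thesis
        by (intro RI[of _ "x - u" "y - v"]) (auto simp: algebra_simps)
    qed
    have qq': "inverse q * inverse q = to_ac \<beta> * inverse q - 1"
      using q by (simp add: \<beta>[symmetric] distrib_right)
    have Rmult: "R (z * w) (z' * w')" if "R z z'" "R w w'" for z z' w w'
    proof -
      from that obtain x y u v where *: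
        "z = to_ac x + to_ac y * q" "z' = to_ac x + to_ac y * inverse q"
        "w = to_ac u + to_ac v * q" "w' = to_ac u + to_ac v * inverse q"
        unfolding R_def by blast
      have m: "(a + c * p) * (e + g * p) = (a * e - c * g) + (a * g + c * e + c * g * h) * p"
        if "p * p = h * p - 1" for a c e g h p :: "'k alg_closure"
      proof -
        have "(a + c * p) * (e + g * p) = a * e + (a * g + c * e) * p + c * g * (p * p)"
          by (simp add: algebra_simps)
        also have "\<dots> = (a * e - c * g) + (a * g + c * e + c * g * h) * p"
          unfolding that by (simp add: algebra_simps)
        finally show ?thesis .
      qed
      show ?thesis
        by (rule RI[of _ "x * u - y * v" "x * v + y * u + y * v * \<beta>"])
           (unfold *, simp_all only: m[OF qq] m[OF qq'] to_ac_add to_ac_mult to_ac_diff)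
    qed
    have R0: "y = 0" if "to_ac x + to_ac y * q = 0" for x y
    proof (rule ccontr)
      assume y: "y \<noteq> 0"
      have "to_ac y * q = to_ac (- x)"
        using that by (simp add: add_eq_0_iff)
      hence "q = to_ac (- x / y)"
        using y by (metis nonzero_mult_div_cancel_left to_ac_divide to_ac_eq_0_iff)
      thus False
        using False by blast
    qed
    have Rinv: "R (inverse z) (inverse z')" if "R z z'" for z z'
    proof -
      from that obtain x y where *:
        "z = to_ac x + to_ac y * q" "z' = to_ac x + to_ac y * inverse q"
        unfolding R_def by blast
      have z': "z' = to_ac (x + y * \<beta>) + to_ac (- y) * q"
        unfolding * q2 by (simp add: algebra_simps)
      show ?thesis
      proof (cases "z = 0 \<or> z' = 0")
        case True
        hence "y = 0"
          using R0[of x y] R0[of "x + y * \<beta>" "- y"] *(1) z' by (metis neg_equal_0_iff_equal)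
        thus ?thesis
          using * by (intro RI[of _ "inverse x" 0]) auto
      next
        case nz: False
        define N where "N = x * x + x * y * \<beta> + y * y"
        have "z * z' = to_ac x * to_ac x + to_ac x * to_ac y * (q + inverse q) +
            to_ac y * to_ac y * (q * inverse q)"
          unfolding * by (simp add: algebra_simps)
        also have "\<dots> = to_ac N"
          using q by (simp add: \<beta> N_def)
        finally have N: "z * z' = to_ac N" .
        have N': "R (to_ac (inverse N)) (to_ac (inverse N))"
          by (rule RI[of _ "inverse N" 0]) auto
        have z'z: "R z' z"
          by (rule RI[of _ "x + y * \<beta>" "- y"])
             (unfold z', simp, unfold * q2, simp add: algebra_simps)
        have "inverse z = to_ac (inverse N) * z'" "inverse z' = to_ac (inverse N) * z"
          using nz by (simp_all add: N[symmetric])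
        thus ?thesis
          using Rmult[OF N' z'z] by simp
      qed
    qed
    have Rpow: "R (q ^ n) (inverse q ^ n)" for n
      by (induction n) (auto intro: R1 Rmult Rq simp del: power_inverse)
    have Rp: "R (qpochhammer q q n) (qpochhammer (inverse q) (inverse q) n)" for n
      by (induction n)
         (auto simp: qpochhammer_def simp del: power_inverse intro!: R1 Rmult Rdiff Rq Rpow)
    have "R (qfrac q r s t) (qfrac (inverse q) r s t)"
      unfolding qfrac_def divide_inverse by (intro Rmult Rinv Rp)
    hence "R (qfrac q r s t) (qfrac q r s t)"
      by (simp only: qfrac_inverse[OF q])
    then obtain x y where z: "qfrac q r s t = to_ac x + to_ac y * q"
      and "to_ac x + to_ac y * q = to_ac x + to_ac y * inverse q"
      unfolding R_def by metis
    hence "y = 0 \<or> q = inverse q"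
      by auto
    hence "y = 0 \<or> q * q = 1"
      using q by (metis right_inverse)
    moreover have "q * q \<noteq> 1"
    proof
      assume "q * q = 1"
      hence "q = 1 \<or> q = - 1"
        by (simp add: square_eq_1_iff)
      hence "q = to_ac 1 \<or> q = to_ac (- 1)"
        by simp
      thus False
        using False by blast
    qed
    ultimately show ?thesis
      using z by simp
  qed
qed

end

theory Submission
  imports Defs
begin

text \<open>
  Let \<open>u\<close> span \<open>E\<^sup>*\<^sub>0V\<close>. Since \<open>\<tau>\<^sub>i(A) u\<close> lies in \<open>E\<^sup>*\<^sub>0V + \<dots> + E\<^sup>*\<^sub>iV\<close>, the definition of the split sequence gives
  \<open>E\<^sup>*\<^sub>0 \<tau>\<^sub>i(A) u = \<zeta>\<^sub>i / ((\<theta>\<^sup>*\<^sub>0 - \<theta>\<^sup>*\<^sub>1) \<cdots> (\<theta>\<^sup>*\<^sub>0 - \<theta>\<^sup>*\<^sub>i)) u\<close>; for the system with \<open>E\<close> reversed, \<open>\<tau>\<^sub>i\<close> becomes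
  \<open>\<eta>\<^sub>i\<close>. Hence (ii) and (iii) follow from the polynomial identity
  \<open>\<eta>\<^sub>i = (\<Sum>h. [h, i - h, d - i]\<^sub>q \<eta>\<^sub>i\<^sub>-\<^sub>h(\<theta>\<^sub>0) \<tau>\<^sub>h)\<close>. Expanding
  \<open>E\<^sub>0 = (\<Sum>h. \<tau>\<^sub>h(A) / ((\<theta>\<^sub>0 - \<theta>\<^sub>1) \<cdots> (\<theta>\<^sub>0 - \<theta>\<^sub>h)))\<close> gives the dual formula
  \<open>E\<^sub>0 \<tau>\<^sup>*\<^sub>i(A\<^sup>*) v = \<zeta>\<^sub>i / ((\<theta>\<^sub>0 - \<theta>\<^sub>1) \<cdots> (\<theta>\<^sub>0 - \<theta>\<^sub>i)) v\<close> for \<open>v\<close> in \<open>E\<^sub>0V\<close>, with the same \<open>\<zeta>\<^sub>i\<close>,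
  because only the term \<open>h = i\<close> survives; this yields (i) and (iv).
  The polynomial identity reduces to a three-term relation for \<open>[r, s, t]\<^sub>q\<close>, which needs that both
  eigenvalue sequences are recurrent with the same constant. For this, \<open>A\<^sup>2A\<^sup>*A - AA\<^sup>*A\<^sup>2 = ZA\<^sup>* - A\<^sup>*Z\<close> for
  some polynomial \<open>Z\<close> in \<open>A\<close>, and comparing components shows that \<open>Z\<close> is a cubic.\<close>

section \<open>Recurrent sequences and the scalars \<open>[r, s, t]\<^sub>q\<close>\<close>

text \<open>For \<open>q = -1\<close> the weights \<open>w1\<close>, \<open>w2\<close>, \<open>w3\<close> are 0 or 1 and encode the triples of odd numbers.\<close>

lemma weighted_factorial_recurrence:
  fixes g m :: "nat \<Rightarrow> 'a::field"
  defines "F \<equiv> \<lambda>r s t. g (r + s) * g (r + t) * g (s + t) / (g r * g s * g t * g (r + s + t))"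
  assumes g: "\<And>n. g (Suc n) = m (Suc n) * g n"
    and nz: "\<And>n. n \<le> a + b + s + 2 \<Longrightarrow> g n \<noteq> 0"
    and w: "w1 * m (a + s + 2) * m (b + 1) - w2 * m (a + 1) * m (s + b + 2) = f * w3 * m (s + 1)"
  shows "(w1 * F (Suc a) (Suc s) b - w2 * F a (Suc s) (Suc b)) * m (a + b + 2) =
    f * (w3 * F (Suc a) s (Suc b))"
proof -
  have G: "g a \<noteq> 0" "g b \<noteq> 0" "g s \<noteq> 0" "g (Suc a) \<noteq> 0" "g (Suc b) \<noteq> 0" "g (Suc s) \<noteq> 0"
      "g (Suc (Suc (a + b + s))) \<noteq> 0"
    by (simp_all add: nz)
  \<comment> \<open>The three brackets share the factor \<open>K\<close>; each is \<open>K\<close>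
    times a product of two values of \<open>m\<close>.\<close>
  define K where "K = g (Suc (a + s)) * g (Suc (a + b)) * g (Suc (s + b)) /
    (g (Suc a) * g (Suc s) * g (Suc b) * g (Suc (Suc (a + b + s))))"
  have 1: "F (Suc a) (Suc s) b = K * (m (a + s + 2) * m (b + 1))"
    using G g[of b] g[of "Suc (a + s)"] unfolding F_def K_def
    by (simp add: field_simps add_ac)
  have 2: "F a (Suc s) (Suc b) = K * (m (a + 1) * m (s + b + 2))"
    using G g[of a] g[of "Suc (s + b)"] unfolding F_def K_def
    by (simp add: field_simps add_ac)
  have 3: "F (Suc a) s (Suc b) = K * (m (s + 1) * m (a + b + 2))"
    using G g[of s] g[of "Suc (a + b)"] unfolding F_def K_def
    by (simp add: field_simps add_ac)
  have "(w1 * F (Suc a) (Suc s) b - w2 * F a (Suc s) (Suc b)) =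
      K * (w1 * m (a + s + 2) * m (b + 1) - w2 * m (a + 1) * m (s + b + 2))"
    unfolding 1 2 by (simp add: algebra_simps)
  thus ?thesis unfolding w 3 by (simp add: algebra_simps)
qed

text \<open>In its uses \<open>p\<close> and \<open>f\<close> come from the bracket relation, and
  \<open>p * u\<close>, \<open>f * u\<close> are the two eigenvalue differences, which share the
  cofactor \<open>u\<close>.\<close>

lemma proportional:
  fixes x p f y u :: "'a::comm_semiring_1"
  assumes "x * p = f * y"
  shows "x * (p * u) = f * u * y"
  unfolding mult.assoc[symmetric] assms by (simp add: mult_ac)

section \<open>Recurrent sequences and their closed forms\<close>

definition recurrent :: "nat \<Rightarrow> 'a::field \<Rightarrow> (nat \<Rightarrow> 'a) \<Rightarrow> bool" where
  "recurrent d c \<theta> \<longleftrightarrow> (\<forall>i. i + 3 \<le> d \<longrightarrow> \<theta> i - \<theta> (i + 3) = c * (\<theta> (i + 1) - \<theta> (i + 2)))"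

text \<open>A recurrence of this order is determined by its first three values. These are compared
  even where they lie beyond \<open>d\<close>, because the closed forms are fitted to them in any
  case.\<close>

lemma recurrent_induct:
  assumes "recurrent d c \<theta>"
    and "\<And>i. i + 3 \<le> d \<Longrightarrow> f i - f (i + 3) = c * (f (i + 1) - f (i + 2))"
    and "\<theta> 0 = f 0" "\<theta> 1 = f 1" "\<theta> 2 = f 2" and "i \<le> d"
  shows "\<theta> i = f i"
  using \<open>i \<le> d\<close>
proof (induction i rule: less_induct)
  case (less i)
  show ?case
  proof (cases "i < 3")
    case True
    hence "i = 0 \<or> i = 1 \<or> i = 2" by auto
    thus ?thesis using assms by auto
  next
    case False
    then obtain j where j: "i = j + 3" by (metis le_add_diff_inverse2 not_less)
    have 1: "\<theta> j - \<theta> (j + 3) = c * (\<theta> (j + 1) - \<theta> (j + 2))"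
      using assms(1) less.prems j by (simp add: recurrent_def)
    have 2: "\<theta> j = f j" "\<theta> (j + 1) = f (j + 1)" "\<theta> (j + 2) = f (j + 2)"
      by (rule less.IH; use less.prems j in simp)+
    have 3: "f j - f (j + 3) = c * (f (j + 1) - f (j + 2))"
      using assms(2)[of j] less.prems j by simp
    have "\<theta> j - \<theta> (j + 3) = \<theta> j - f (j + 3)"
      unfolding 1 unfolding 2 3 ..
    thus ?thesis using j by simp
  qed
qed

text \<open>The characteristic equation \<open>1 - x ^ 3 = (q + inverse q + 1) * (x - x ^ 2)\<close>
  has the roots 1, \<open>q\<close> and \<open>inverse q\<close>, which are distinct because
  \<open>q\<close> is neither 1 nor -1.\<close>

lemma recurrent_geometric:
  fixes \<theta> :: "nat \<Rightarrow> 'a::field"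
  assumes rec: "recurrent d (q + inverse q + 1) \<theta>" and q: "q \<noteq> 0" "q \<noteq> 1" "q \<noteq> -1"
  obtains x y z where "\<And>i. i \<le> d \<Longrightarrow> \<theta> i = x + y * q ^ i + z * inverse q ^ i"
proof -
  define p where "p = inverse q"
  have pq: "p * q = 1" using q by (simp add: p_def)
  have qp: "q - p \<noteq> 0"
  proof
    assume "q - p = 0"
    hence "q * q = 1" using pq by simp
    thus False using q by (simp add: square_eq_1_iff)
  qed
  have p1: "p - 1 \<noteq> 0" "q - 1 \<noteq> 0" using q pq by auto
  define u where "u = \<theta> 1 - \<theta> 0"
  define v where "v = \<theta> 2 - \<theta> 1"
  \<comment> \<open>\<open>y\<close> and \<open>z\<close> solve
    \<open>y * (q - 1) + z * (p - 1) = u\<close> and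
    \<open>q * (y * (q - 1)) + p * (z * (p - 1)) = v\<close>, which match the first two
    differences.\<close>
  define y where "y = (v - p * u) / ((q - p) * (q - 1))"
  define z where "z = (q * u - v) / ((q - p) * (p - 1))"
  define x where "x = \<theta> 0 - y - z"
  have yz: "y * (q - 1) = (v - p * u) / (q - p)" "z * (p - 1) = (q * u - v) / (q - p)"
    using p1 by (simp_all add: y_def z_def)
  have "v - p * u + (q * u - v) = (q - p) * u" "q * (v - p * u) + p * (q * u - v) = (q - p) * v"
    by (simp_all add: algebra_simps)
  note uv = this
  have "y * (q - 1) + z * (p - 1) = u"
    unfolding yz add_divide_distrib[symmetric] uv using qp by simp
  hence t1: "\<theta> 1 = x + y * q + z * p" by (simp add: u_def x_def algebra_simps)
  have "q * (y * (q - 1)) + p * (z * (p - 1)) = v"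
    unfolding yz times_divide_eq_right add_divide_distrib[symmetric] uv using qp by simp
  hence "\<theta> 2 = \<theta> 1 + q * (y * (q - 1)) + p * (z * (p - 1))" by (simp add: v_def algebra_simps)
  hence t2: "\<theta> 2 = x + y * q ^ 2 + z * p ^ 2"
    unfolding t1 by (simp add: algebra_simps power2_eq_square)
  have "\<theta> i = x + y * q ^ i + z * p ^ i" if "i \<le> d" for i
  proof (rule recurrent_induct[OF rec[folded p_def] _ _ _ _ that])
    fix i
    have cube: "1 - u ^ 3 = (u + v + 1) * (u - u ^ 2)" if "v * u = 1" for u v :: 'a
    proof -
      have "(u + v + 1) * (u - u ^ 2) = u * u + v * u + u - u ^ 3 - (v * u) * u - u * u"
        by (simp add: algebra_simps power2_eq_square power3_eq_cube)
      thus ?thesis unfolding that by simp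
    qed
    have a: "1 - q ^ 3 = (q + p + 1) * (q - q ^ 2)" "1 - p ^ 3 = (q + p + 1) * (p - p ^ 2)"
      using cube[of p q] cube[of q p] pq by (simp_all add: add_ac mult_ac)
    have "(x + y * q ^ i + z * p ^ i) - (x + y * q ^ (i + 3) + z * p ^ (i + 3)) =
        y * q ^ i * (1 - q ^ 3) + z * p ^ i * (1 - p ^ 3)"
      by (simp add: power_add algebra_simps)
    also have "\<dots> = (q + p + 1) * ((x + y * q ^ (i + 1) + z * p ^ (i + 1)) -
        (x + y * q ^ (i + 2) + z * p ^ (i + 2)))"
      unfolding a by (simp add: power_add algebra_simps power2_eq_square)
    finally show "(x + y * q ^ i + z * p ^ i) - (x + y * q ^ (i + 3) + z * p ^ (i + 3)) =
        (q + p + 1) * ((x + y * q ^ (i + 1) + z * p ^ (i + 1)) -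
        (x + y * q ^ (i + 2) + z * p ^ (i + 2)))" .
  qed (use t1 t2 in \<open>simp_all add: x_def\<close>)
  thus ?thesis using that unfolding p_def by blast
qed

section \<open>The three-term relation and the polynomial identity it implies\<close>

definition bracket_recurrence ::
    "nat \<Rightarrow> (nat \<Rightarrow> 'k::field) \<Rightarrow> (nat \<Rightarrow> nat \<Rightarrow> nat \<Rightarrow> 'k) \<Rightarrow> bool" where
  "bracket_recurrence d \<theta> br \<longleftrightarrow>
     (\<forall>s t. s + t = d \<longrightarrow> br 0 s t = 1 \<and> br s 0 t = 1) \<and>
     (\<forall>a b s. a + b + s + 2 = d \<longrightarrow>
        (br (Suc a) (Suc s) b - br a (Suc s) (Suc b)) * (\<theta> 0 - \<theta> (a + b + 2)) =
        (\<theta> (Suc a) - \<theta> (Suc b)) * br (Suc a) s (Suc b))"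

text \<open>Induction on \<open>i\<close>, multiplying by the next linear factor. Comparing
  coefficients of \<open>tau_poly \<theta> (Suc h)\<close> leads to the second clause of
  \<open>bracket_recurrence\<close> times a value of \<open>eta_poly\<close>; the first clause
  settles the two end coefficients.\<close>

lemma eta_poly_expansion:
  assumes br: "bracket_recurrence d \<theta> br" and "i \<le> d"
  shows "eta_poly d \<theta> i =
    (\<Sum>h=0..i. smult (br h (i - h) (d - i) * poly (eta_poly d \<theta> (i - h)) (\<theta> 0)) (tau_poly \<theta> h))"
  using \<open>i \<le> d\<close>
proof (induction i)
  case 0
  thus ?case using br by (simp add: eta_poly_def tau_poly_def bracket_recurrence_def)
next
  case (Suc i)
  define c where "c i h = br h (i - h) (d - i) * poly (eta_poly d \<theta> (i - h)) (\<theta> 0)" for i h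
  have eS: "eta_poly d \<theta> (Suc n) = eta_poly d \<theta> n * [:- \<theta> (d - n), 1:]" for n
    by (simp add: eta_poly_def)
  have tS: "tau_poly \<theta> h * [:- x, 1:] = tau_poly \<theta> (Suc h) + smult (\<theta> h - x) (tau_poly \<theta> h)"
    for h x
    by (simp add: tau_poly_def algebra_simps flip: smult_add_left)
  have c0: "c (Suc i) 0 = (\<theta> 0 - \<theta> (d - i)) * c i 0"
    using br Suc.prems by (simp add: c_def bracket_recurrence_def eS algebra_simps)
  have ci: "c (Suc i) (Suc i) = c i i"
    using br Suc.prems by (simp add: c_def bracket_recurrence_def eta_poly_def)
  have cS: "c (Suc i) (Suc h) = c i h + (\<theta> (Suc h) - \<theta> (d - i)) * c i (Suc h)" if "h < i" for h
  proof -
    obtain s where s: "i = Suc (h + s)" using \<open>h < i\<close> less_imp_Suc_add by blast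
    obtain b where b: "d = Suc i + b" using Suc.prems by (metis le_iff_add)
    have "(br (Suc h) (Suc s) b - br h (Suc s) (Suc b)) * (\<theta> 0 - \<theta> (h + b + 2)) =
        (\<theta> (Suc h) - \<theta> (Suc b)) * br (Suc h) s (Suc b)"
      using br b s by (simp add: bracket_recurrence_def)
    hence e: "br (Suc h) (Suc s) b * (\<theta> 0 - \<theta> (h + b + 2)) =
        br h (Suc s) (Suc b) * (\<theta> 0 - \<theta> (h + b + 2)) +
        (\<theta> (Suc h) - \<theta> (Suc b)) * br (Suc h) s (Suc b)"
      by (simp add: algebra_simps)
    \<comment> \<open>The factor that turns \<open>eta_poly d \<theta> s\<close> into
      \<open>eta_poly d \<theta> (Suc s)\<close> has the root \<open>\<theta> (d - s)\<close>, which
      is the eigenvalue on the left of the bracket relation for \<open>a = h\<close>.\<close>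
    have ds: "d - s = h + b + 2" using b s by simp
    have e': "poly (eta_poly d \<theta> (Suc s)) (\<theta> 0) =
        poly (eta_poly d \<theta> s) (\<theta> 0) * (\<theta> 0 - \<theta> (h + b + 2))"
      unfolding eS ds by (simp add: algebra_simps)
    have ix: "Suc i - Suc h = Suc s" "d - Suc i = b" "i - h = Suc s" "d - i = Suc b" "i - Suc h = s"
      using b s by auto
    have "c (Suc i) (Suc h) = br (Suc h) (Suc s) b * (\<theta> 0 - \<theta> (h + b + 2)) *
        poly (eta_poly d \<theta> s) (\<theta> 0)"
      unfolding c_def ix e' by (simp add: algebra_simps)
    also have "\<dots> = c i h + (\<theta> (Suc h) - \<theta> (d - i)) * c i (Suc h)"
      unfolding e c_def ix e' by (simp add: algebra_simps)
    finally show ?thesis .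
  qed
  have IH: "eta_poly d \<theta> i = (\<Sum>h\<le>i. smult (c i h) (tau_poly \<theta> h))"
    using Suc by (simp add: c_def atMost_atLeast0)
  have "eta_poly d \<theta> (Suc i) = (\<Sum>h\<le>i. smult (c i h) (tau_poly \<theta> h * [:- \<theta> (d - i), 1:]))"
    unfolding eS IH sum_distrib_right by (simp only: mult_smult_left)
  also have "\<dots> = (\<Sum>h\<le>i. smult (c i h) (tau_poly \<theta> (Suc h))) +
      (\<Sum>h\<le>i. smult ((\<theta> h - \<theta> (d - i)) * c i h) (tau_poly \<theta> h))"
    unfolding tS by (simp add: smult_add_right sum.distrib mult_ac)
  also have "(\<Sum>h\<le>i. smult (c i h) (tau_poly \<theta> (Suc h))) =
      (\<Sum>h<i. smult (c i h) (tau_poly \<theta> (Suc h))) + smult (c (Suc i) (Suc i)) (tau_poly \<theta> (Suc i))"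
    by (simp add: ci lessThan_Suc_atMost[symmetric])
  also have "(\<Sum>h\<le>i. smult ((\<theta> h - \<theta> (d - i)) * c i h) (tau_poly \<theta> h)) =
      smult (c (Suc i) 0) (tau_poly \<theta> 0) +
      (\<Sum>h<i. smult ((\<theta> (Suc h) - \<theta> (d - i)) * c i (Suc h)) (tau_poly \<theta> (Suc h)))"
    by (simp only: c0 lessThan_Suc_atMost[symmetric] sum.lessThan_Suc_shift)
  also have "(\<Sum>h<i. smult (c i h) (tau_poly \<theta> (Suc h))) +
        smult (c (Suc i) (Suc i)) (tau_poly \<theta> (Suc i)) +
        (smult (c (Suc i) 0) (tau_poly \<theta> 0) +
         (\<Sum>h<i. smult ((\<theta> (Suc h) - \<theta> (d - i)) * c i (Suc h)) (tau_poly \<theta> (Suc h)))) =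
      smult (c (Suc i) 0) (tau_poly \<theta> 0) +
      (\<Sum>h<i. smult (c (Suc i) (Suc h)) (tau_poly \<theta> (Suc h))) +
      smult (c (Suc i) (Suc i)) (tau_poly \<theta> (Suc i))"
    by (simp add: cS smult_add_left sum.distrib)
  also have "\<dots> = (\<Sum>h<Suc (Suc i). smult (c (Suc i) h) (tau_poly \<theta> h))"
    by (subst sum.lessThan_Suc_shift) (simp only: sum.lessThan_Suc add.assoc)
  finally show ?case by (simp only: c_def lessThan_Suc_atMost atMost_atLeast0)
qed


section \<open>The three-term relation for each kind of \<open>q\<close>\<close>

lemma bracket_boundary:
  fixes g :: "nat \<Rightarrow> 'a::field"
  assumes "g 0 = 1" and "\<And>n. n \<le> r + s + t \<Longrightarrow> g n \<noteq> 0" and "r = 0 \<or> s = 0 \<or> t = 0"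
  shows "g (r + s) * g (r + t) * g (s + t) / (g r * g s * g t * g (r + s + t)) = 1"
  using assms by (auto simp: field_simps)

text \<open>With \<open>n = a + b + 2\<close>, the closed form makes both eigenvalue differences
  multiples of \<open>y - z * inverse q ^ n\<close>. The cofactors
  \<open>q ^ Suc a - q ^ Suc b\<close> and \<open>1 - q ^ n\<close> are those of a relation between
  q-factorials, proved in the algebraic closure and pulled back.\<close>

lemma qbracket_recurrence_generic:
  fixes \<theta> :: "nat \<Rightarrow> 'k::field" and q :: "'k alg_closure"
  assumes inj: "inj_on \<theta> {..d}" and q: "q \<noteq> 0" "q \<noteq> 1" "q \<noteq> -1"
    and rec: "recurrent d c \<theta>" and c: "d \<ge> 3 \<Longrightarrow> to_ac c = q + inverse q + 1"
  shows "bracket_recurrence d \<theta> (qbracket q)"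
proof -
  have "recurrent d (q + inverse q + 1) (\<lambda>i. to_ac (\<theta> i))"
    using rec c unfolding recurrent_def
    by (metis add_leD2 to_ac_diff to_ac_mult)
  then obtain x y z where th: "\<And>i. i \<le> d \<Longrightarrow> to_ac (\<theta> i) = x + y * q ^ i + z * inverse q ^ i"
    using recurrent_geometric[OF _ q] by blast
  \<comment> \<open>Distinctness of the eigenvalues keeps the denominators nonzero:
    \<open>q ^ n = 1\<close> would give \<open>\<theta> n = \<theta> 0\<close>.\<close>
  have q1: "q ^ n \<noteq> 1" if n: "0 < n" "n \<le> d" for n
  proof
    assume "q ^ n = 1"
    hence "to_ac (\<theta> n) = to_ac (\<theta> 0)"
      using th[of n] th[of 0] n by (simp add: power_inverse)
    hence "n = 0" using inj_onD[OF inj, of n 0] n by simp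
    thus False using n by simp
  qed
  have pS: "qpochhammer q q (Suc n) = (1 - q ^ Suc n) * qpochhammer q q n" for n
    by (simp add: qpochhammer_def)
  have p0: "qpochhammer q q 0 = 1" by (simp add: qpochhammer_def)
  have nz: "qpochhammer q q n \<noteq> 0" if "n \<le> d" for n
    using that
  proof (induction n)
    case (Suc n)
    thus ?case unfolding pS using q1[of "Suc n"] by simp
  qed (simp add: p0)
  have triv: "qfrac q r s t = 1" if "r + s + t = d" "r = 0 \<or> s = 0 \<or> t = 0" for r s t
    unfolding qfrac_def by (rule bracket_boundary) (use p0 nz that in auto)
  have br: "to_ac (qbracket q r s t) = qfrac q r s t" if "r + s + t = d" for r s t
  proof -
    have "qfrac q r s t \<in> range to_ac"
    proof (cases "d \<ge> 3")
      case True
      have "q + inverse q = to_ac (c - 1)" using c[OF True] by (simp add: algebra_simps)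
      thus ?thesis using qfrac_in_base_field[OF q(1)] by blast
    next
      \<comment> \<open>For \<open>d < 3\<close> nothing ties \<open>q\<close> to the base field,
        but then some index is 0 and the bracket is 1.\<close>
      case False
      hence "r = 0 \<or> s = 0 \<or> t = 0" using that by auto
      hence "qfrac q r s t = to_ac 1" using triv[OF that] by simp
      thus ?thesis by blast
    qed
    thus ?thesis using q by (simp add: qbracket_def to_ac_of_ac)
  qed
  have "qbracket q 0 s t = 1 \<and> qbracket q s 0 t = 1" if "s + t = d" for s t
    using br[of 0 s t] br[of s 0 t] triv[of 0 s t] triv[of s 0 t] that
    by (metis add_0 add_0_right to_ac_1 to_ac_eq_iff)
  moreover have "(qbracket q (Suc a) (Suc s) b - qbracket q a (Suc s) (Suc b)) *
      (\<theta> 0 - \<theta> (a + b + 2)) = (\<theta> (Suc a) - \<theta> (Suc b)) * qbracket q (Suc a) s (Suc b)"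
    if n: "a + b + s + 2 = d" for a b s
  proof -
    define n where "n = a + b + 2"
    define f where "f = q ^ Suc a - q ^ Suc b"
    have F: "(qfrac q (Suc a) (Suc s) b - qfrac q a (Suc s) (Suc b)) * (1 - q ^ n) =
        f * qfrac q (Suc a) s (Suc b)"
      using weighted_factorial_recurrence[of "qpochhammer q q" "\<lambda>n. 1 - q ^ n" a b s 1 1 f 1,
          OF pS nz] n
      by (simp add: qfrac_def n_def f_def algebra_simps power_add)
    have qn: "q ^ Suc a * inverse q ^ n = inverse q ^ Suc b"
        "q ^ Suc b * inverse q ^ n = inverse q ^ Suc a"
      using q by (simp_all add: n_def power_inverse field_simps power_add)
    have T: "to_ac (\<theta> (Suc a)) - to_ac (\<theta> (Suc b)) = f * (y - z * inverse q ^ n)"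
      using n th[of "Suc a"] th[of "Suc b"] by (simp only: f_def algebra_simps mult.assoc qn)
    have T0: "to_ac (\<theta> 0) - to_ac (\<theta> n) = (1 - q ^ n) * (y - z * inverse q ^ n)"
      using n q th[of 0] th[of n] by (simp add: n_def algebra_simps power_inverse)
    have "(qfrac q (Suc a) (Suc s) b - qfrac q a (Suc s) (Suc b)) * (to_ac (\<theta> 0) - to_ac (\<theta> n)) =
        (to_ac (\<theta> (Suc a)) - to_ac (\<theta> (Suc b))) * qfrac q (Suc a) s (Suc b)"
      unfolding T T0 by (rule proportional[OF F])
    hence "to_ac ((qbracket q (Suc a) (Suc s) b - qbracket q a (Suc s) (Suc b)) *
        (\<theta> 0 - \<theta> n)) = to_ac ((\<theta> (Suc a) - \<theta> (Suc b)) * qbracket q (Suc a) s (Suc b))"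
      using n by (simp add: br)
    thus ?thesis by (simp add: n_def del: to_ac_mult to_ac_diff)
  qed
  ultimately show ?thesis unfolding bracket_recurrence_def by blast
qed

lemma two_neq_0_if_CHAR_neq_2:
  assumes "CHAR('k::field) \<noteq> 2"
  shows "(2::'k) \<noteq> 0"
proof
  assume "(2::'k) = 0"
  hence "CHAR('k) dvd 2" by (metis of_nat_eq_0_iff_char_dvd of_nat_numeral)
  hence "CHAR('k) = 1" using assms by (metis prime_nat_iff two_is_prime_nat)
  thus False by simp
qed

text \<open>At \<open>q = 1\<close> the solutions are quadratic in the index, as 2 is invertible.
  Both eigenvalue differences contain \<open>- (y + z * of_nat n)\<close> with
  \<open>n = a + b + 2\<close>, which leaves the factors \<open>of_nat b - of_nat a\<close> and
  \<open>of_nat n\<close> of the relation between factorials.\<close>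

lemma qbracket_recurrence_1:
  fixes \<theta> :: "nat \<Rightarrow> 'k::field"
  assumes inj: "inj_on \<theta> {..d}" and char: "CHAR('k) \<noteq> 2" and rec: "recurrent d 3 \<theta>"
  shows "bracket_recurrence d \<theta> (qbracket 1)"
proof -
  note two = two_neq_0_if_CHAR_neq_2[OF char]
  have one: "(1::'k alg_closure) \<noteq> -1"
  proof
    assume "(1::'k alg_closure) = -1"
    hence "to_ac (1::'k) = to_ac (-1)" by simp
    hence "(1::'k) = -1" by (simp only: to_ac_eq_iff)
    thus False using two by (metis add.right_inverse one_add_one)
  qed
  define z where "z = (\<theta> 2 - 2 * \<theta> 1 + \<theta> 0) / 2"
  define y where "y = \<theta> 1 - \<theta> 0 - z"
  have z2: "2 * z = \<theta> 2 - 2 * \<theta> 1 + \<theta> 0" using two by (simp add: z_def)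
  have th: "\<theta> i = \<theta> 0 + y * of_nat i + z * of_nat i ^ 2" if "i \<le> d" for i
  proof (rule recurrent_induct[OF rec _ _ _ _ that])
    show "\<theta> 2 = \<theta> 0 + y * of_nat 2 + z * of_nat 2 ^ 2"
      using z2 by (simp add: y_def algebra_simps power2_eq_square)
  qed (simp_all add: y_def algebra_simps power2_eq_square)
  have nz0: "(of_nat n :: 'k) \<noteq> 0" if "0 < n" "n \<le> d" for n
  proof
    assume "(of_nat n :: 'k) = 0"
    hence "\<theta> n = \<theta> 0" using th[of n] that by simp
    thus False using inj_onD[OF inj, of n 0] that by simp
  qed
  define g where "g n = (of_nat (fact n) :: 'k)" for n
  have g0: "g 0 = 1" and gS: "g (Suc n) = of_nat (Suc n) * g n" for n
    unfolding g_def by (simp_all only: fact_0 fact_Suc of_nat_mult of_nat_1 of_nat_id)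
  have nz: "g n \<noteq> 0" if "n \<le> d" for n
    using that
  proof (induction n)
    case (Suc n)
    thus ?case unfolding gS using nz0[of "Suc n"] by (simp del: of_nat_Suc)
  qed (simp add: g0)
  have bd: "g (r + s) * g (r + t) * g (s + t) / (g r * g s * g t * g (r + s + t)) = 1"
    if "r + s + t = d" "r = 0 \<or> s = 0" for r s t
    by (rule bracket_boundary) (use g0 nz that in auto)
  have br: "qbracket 1 r s t = g (r + s) * g (r + t) * g (s + t) / (g r * g s * g t * g (r + s + t))"
    for r s t
    using char one by (simp add: qbracket_def g_def)
  have "qbracket 1 0 s t = (1::'k) \<and> qbracket 1 s 0 t = (1::'k)" if "s + t = d" for s t
    unfolding br using bd[of 0 s t] bd[of s 0 t] that by simp
  moreover have "(qbracket 1 (Suc a) (Suc s) b - qbracket 1 a (Suc s) (Suc b)) *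
      (\<theta> 0 - \<theta> (a + b + 2)) = (\<theta> (Suc a) - \<theta> (Suc b)) * qbracket 1 (Suc a) s (Suc b)"
    if n: "a + b + s + 2 = d" for a b s
  proof -
    define n where "n = a + b + 2"
    define f :: 'k where "f = of_nat b - of_nat a"
    have F: "(qbracket 1 (Suc a) (Suc s) b - qbracket 1 a (Suc s) (Suc b)) * of_nat n =
        f * qbracket 1 (Suc a) s (Suc b)"
      using weighted_factorial_recurrence[of g of_nat a b s 1 1 f 1, OF gS nz] n
      by (simp add: br n_def f_def algebra_simps)
    have T: "\<theta> (Suc a) - \<theta> (Suc b) = f * - (y + z * of_nat n)"
      using n th[of "Suc a"] th[of "Suc b"] by (simp add: f_def n_def algebra_simps power2_eq_square)
    have T0: "\<theta> 0 - \<theta> n = of_nat n * - (y + z * of_nat n)"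
      using n th[of n] by (simp add: n_def algebra_simps power2_eq_square)
    show ?thesis
      unfolding n_def[symmetric] T T0 by (rule proportional[OF F])
  qed
  ultimately show ?thesis unfolding bracket_recurrence_def by blast
qed

text \<open>At \<open>q = -1\<close> the terms of even index form an arithmetic progression with
  step \<open>y\<close>, those of odd index one with step \<open>- y\<close>. The factorials of
  halves obey a one-step recursion whose multiplier \<open>m\<close> depends on parity, so the
  weighted factorial relation applies.\<close>

lemma qbracket_recurrence_minus_1:
  fixes \<theta> :: "nat \<Rightarrow> 'k::field"
  assumes inj: "inj_on \<theta> {..d}" and char: "CHAR('k) \<noteq> 2" and rec: "recurrent d (-1) \<theta>"
  shows "bracket_recurrence d \<theta> (qbracket (-1))"
proof -
  note two = two_neq_0_if_CHAR_neq_2[OF char]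
  have one: "(-1::'k alg_closure) \<noteq> 1"
  proof
    assume "(-1::'k alg_closure) = 1"
    hence "to_ac (1::'k) = to_ac (-1)" by simp
    hence "(1::'k) = -1" by (simp only: to_ac_eq_iff)
    thus False using two by (metis add.right_inverse one_add_one)
  qed
  define y where "y = \<theta> 2 - \<theta> 0"
  define h where "h i = (if even i then \<theta> 0 + y * of_nat (i div 2) else \<theta> 1 - y * of_nat (i div 2))"
    for i
  have th: "\<theta> i = h i" if "i \<le> d" for i
    by (rule recurrent_induct[OF rec _ _ _ _ that]) (auto simp: h_def y_def algebra_simps elim!: evenE oddE)
  have nz0: "(of_nat n :: 'k) \<noteq> 0" if "0 < n" "2 * n \<le> d" for n
  proof
    assume "(of_nat n :: 'k) = 0"
    hence "\<theta> (2 * n) = \<theta> 0" using th[of "2 * n"] that by (simp add: h_def)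
    thus False using inj_onD[OF inj, of "2 * n" 0] that by simp
  qed
  define g where "g n = (of_nat (fact (n div 2)) :: 'k)" for n
  define m where "m n = (if even n then of_nat (n div 2) else 1 :: 'k)" for n
  have g0: "g 0 = 1" by (simp add: g_def)
  have gS: "g (Suc n) = m (Suc n) * g n" for n
    unfolding g_def m_def by (cases "even n") (auto elim!: evenE oddE simp: algebra_simps)
  have nz: "g n \<noteq> 0" if "n \<le> d" for n
    using that
  proof (induction n)
    case (Suc n)
    have "m (Suc n) \<noteq> 0" using Suc.prems nz0[of "Suc n div 2"] by (auto simp: m_def elim!: oddE simp del: of_nat_Suc)
    thus ?case unfolding gS using Suc by simp
  qed (simp add: g0)
  define w where "w r s t = (if odd r \<and> odd s \<and> odd t then 0 else 1 :: 'k)" for r s t :: nat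
  have bd: "g (r + s) * g (r + t) * g (s + t) / (g r * g s * g t * g (r + s + t)) = 1"
    if "r + s + t = d" "r = 0 \<or> s = 0" for r s t
    by (rule bracket_boundary) (use g0 nz that in auto)
  have br: "qbracket (-1) r s t =
      w r s t * (g (r + s) * g (r + t) * g (s + t) / (g r * g s * g t * g (r + s + t)))"
    for r s t
    using char one by (simp add: qbracket_def g_def w_def)
  have "qbracket (-1) 0 s t = (1::'k) \<and> qbracket (-1) s 0 t = (1::'k)" if "s + t = d" for s t
    unfolding br using bd[of 0 s t] bd[of s 0 t] that by (simp add: w_def)
  moreover have "(qbracket (-1) (Suc a) (Suc s) b - qbracket (-1) a (Suc s) (Suc b)) *
      (\<theta> 0 - \<theta> (a + b + 2)) = (\<theta> (Suc a) - \<theta> (Suc b)) * qbracket (-1) (Suc a) s (Suc b)"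
    if n: "a + b + s + 2 = d" for a b s
  proof -
    define n where "n = a + b + 2"
    \<comment> \<open>This \<open>f\<close> serves twice: it balances the weights, and it links the
      two eigenvalue differences. Both relations carry the factor \<open>m n\<close>, which cancels
      at the end.\<close>
    define f :: 'k where "f = (if odd a then if odd b then of_nat (Suc b div 2) - of_nat (Suc a div 2) else 1
      else if odd b then - 1 else of_nat (Suc a div 2) - of_nat (Suc b div 2))"
    have w: "w (Suc a) (Suc s) b * m (a + s + 2) * m (b + 1) - w a (Suc s) (Suc b) * m (a + 1) * m (s + b + 2)
        = f * w (Suc a) s (Suc b) * m (s + 1)"
      by (cases "even a"; cases "even b"; cases "even s")
        (auto simp: w_def m_def f_def algebra_simps elim!: evenE oddE)
    have F: "(qbracket (-1) (Suc a) (Suc s) b - qbracket (-1) a (Suc s) (Suc b)) * m n =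
        f * qbracket (-1) (Suc a) s (Suc b)"
      unfolding br n_def
      by (rule weighted_factorial_recurrence[of g m a b s, OF gS nz w]) (use n in simp)
    have "(h (Suc a) - h (Suc b)) * m n = f * (h 0 - h n)"
      by (cases "even a"; cases "even b")
        (auto simp: h_def m_def f_def n_def algebra_simps elim!: evenE oddE)
    hence T: "(\<theta> (Suc a) - \<theta> (Suc b)) * m n = f * (\<theta> 0 - \<theta> n)"
      using n th[of "Suc a"] th[of "Suc b"] th[of n] th[of 0] by (simp add: n_def)
    have m: "m n \<noteq> 0"
      using gS[of "a + b + 1"] nz[of n] n by (auto simp: n_def)
    have "((qbracket (-1) (Suc a) (Suc s) b - qbracket (-1) a (Suc s) (Suc b)) * (\<theta> 0 - \<theta> n)) * m n =
        ((\<theta> (Suc a) - \<theta> (Suc b)) * qbracket (-1) (Suc a) s (Suc b)) * m n"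
      using F T by (metis (no_types, opaque_lifting) mult.assoc mult.commute)
    thus ?thesis using m by (simp add: n_def)
  qed
  ultimately show ?thesis unfolding bracket_recurrence_def by blast
qed

text \<open>Two instances of the recurrence would give \<open>\<theta> 0 = \<theta> 4\<close> if
  \<open>d\<close> exceeded 3. So only a few triples occur, and the relation is checked on
  each.\<close>

lemma qbracket_recurrence_char_2:
  fixes \<theta> :: "nat \<Rightarrow> 'k::field"
  assumes inj: "inj_on \<theta> {..d}" and char: "CHAR('k) = 2" and rec: "recurrent d 1 \<theta>"
    and q: "q = 1 \<or> q = -1"
  shows "bracket_recurrence d \<theta> (qbracket q)"
proof -
  have two: "(2::'k) = 0" using of_nat_CHAR[where ?'a = 'k] char by simp
  have neg: "- x = x" for x :: 'k using two by (metis add_eq_0_iff mult_2 mult_zero_left)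
  have "d \<le> 3"
  proof (rule ccontr)
    assume "\<not> d \<le> 3"
    hence "\<theta> 0 - \<theta> 3 = \<theta> 1 - \<theta> 2" "\<theta> 1 - \<theta> 4 = \<theta> 2 - \<theta> 3"
      using rec by (auto simp: recurrent_def dest: spec[of _ 0] spec[of _ 1] simp flip: numeral_2_eq_2)
    hence "\<theta> 0 = \<theta> 4" by (simp add: algebra_simps)
    thus False using inj_onD[OF inj, of 0 4] \<open>\<not> d \<le> 3\<close> by simp
  qed
  have br: "qbracket q r s t = (if r = 1 \<and> s = 1 \<and> t = 1 then 0 else 1)" for r s t
    using q char by (auto simp: qbracket_def)
  have r3: "\<theta> 0 - \<theta> 3 = \<theta> 1 - \<theta> 2" if "d = 3"
    using rec that by (simp add: recurrent_def numeral_2_eq_2)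
  have "(br1 (Suc a) (Suc s) b - br1 a (Suc s) (Suc b)) * (\<theta> 0 - \<theta> (a + b + 2)) =
      (\<theta> (Suc a) - \<theta> (Suc b)) * br1 (Suc a) s (Suc b)"
    if n: "a + b + s + 2 = d" and b1: "br1 = qbracket q" for a b s br1
  proof -
    have "a + b + s \<le> 1" using n \<open>d \<le> 3\<close> by simp
    hence "(a = 0 \<and> b = 0 \<and> s \<le> 1) \<or> (a = 1 \<and> b = 0 \<and> s = 0) \<or> (a = 0 \<and> b = 1 \<and> s = 0)" by auto
    thus ?thesis
      using r3 n neg[of "\<theta> 1 - \<theta> 2"] unfolding b1 br by (auto simp: numeral_2_eq_2 numeral_3_eq_3)
  qed
  thus ?thesis unfolding bracket_recurrence_def by (auto simp: br)
qed

lemma qbracket_recurrence: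
  fixes \<theta> :: "nat \<Rightarrow> 'k::field" and q :: "'k alg_closure"
  assumes inj: "inj_on \<theta> {..d}" and q: "q \<noteq> 0"
    and rec: "recurrent d c \<theta>" and c: "d \<ge> 3 \<Longrightarrow> to_ac c = q + inverse q + 1"
  shows "bracket_recurrence d \<theta> (qbracket q)"
proof -
  \<comment> \<open>For \<open>d < 3\<close> the constant \<open>c\<close> is unrelated to
    \<open>q\<close>, but then the recurrence is vacuous and holds for every constant.\<close>
  have rec': "recurrent d c' \<theta>" if "to_ac c' = q + inverse q + 1" for c'
  proof (cases "d \<ge> 3")
    case True
    hence "c' = c" using c that by (metis to_ac_eq_iff)
    thus ?thesis using rec by simp
  qed (simp add: recurrent_def)
  consider "q \<noteq> 1" "q \<noteq> -1" | "CHAR('k) = 2" "q = 1 \<or> q = -1"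
    | "CHAR('k) \<noteq> 2" "q = 1" | "CHAR('k) \<noteq> 2" "q = -1" by blast
  thus ?thesis
  proof cases
    case 1
    thus ?thesis using qbracket_recurrence_generic[OF inj q _ _ rec c] by blast
  next
    case 2
    have "(2::'k) = 0" using of_nat_CHAR[where ?'a = 'k] 2(1) by simp
    hence "to_ac (2::'k) = 0" by simp
    hence "(2::'k alg_closure) = 0" by simp
    hence "q + inverse q = 0"
      using 2(2) by (metis add.inverse_inverse add.inverse_neutral inverse_1 inverse_minus_eq minus_add_distrib one_add_one)
    hence "recurrent d 1 \<theta>" by (intro rec') simp
    thus ?thesis using qbracket_recurrence_char_2[OF inj 2(1) _ 2(2)] by blast
  next
    case 3
    have "recurrent d 3 \<theta>" by (intro rec') (simp add: 3)
    thus ?thesis using qbracket_recurrence_1[OF inj 3(1)] 3 by simp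
  next
    case 4
    have "recurrent d (-1) \<theta>" by (intro rec') (simp add: 4)
    thus ?thesis using qbracket_recurrence_minus_1[OF inj 4(1)] 4 by simp
  qed
qed

section \<open>Reversal, interpolation and divided differences\<close>

lemma inj_on_reverse:
  fixes f :: "nat \<Rightarrow> 'a"
  assumes "inj_on f {..d}"
  shows "inj_on (\<lambda>i. f (d - i)) {..d}"
proof (rule inj_onI)
  fix i j assume "i \<in> {..d}" "j \<in> {..d}" "f (d - i) = f (d - j)"
  moreover from this have "d - i = d - j" by (intro inj_onD[OF assms]) auto
  ultimately show "i = j" by auto
qed

text \<open>Reversing the eigenvalues exchanges \<open>tau_poly\<close> and \<open>eta_poly\<close>,
  so this is \<open>eta_poly_expansion\<close> for the reversed sequence.\<close>

lemma tau_poly_expansion: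
  assumes br: "bracket_recurrence d (\<lambda>i. \<theta> (d - i)) br" and "i \<le> d"
  shows "tau_poly \<theta> i =
    (\<Sum>h=0..i. smult (br h (i - h) (d - i) * poly (tau_poly \<theta> (i - h)) (\<theta> d)) (eta_poly d \<theta> h))"
proof -
  have e: "eta_poly d (\<lambda>i. \<theta> (d - i)) n = tau_poly \<theta> n" if "n \<le> d" for n
    unfolding eta_poly_def tau_poly_def using that by (intro prod.cong) auto
  have t: "tau_poly (\<lambda>i. \<theta> (d - i)) n = eta_poly d \<theta> n" for n
    unfolding eta_poly_def tau_poly_def ..
  show ?thesis
    using eta_poly_expansion[OF br \<open>i \<le> d\<close>] e \<open>i \<le> d\<close> by (simp add: t)
qed

text \<open>Each new node adds a multiple of the product that vanishes at all earlier nodes. The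
  Newton basis is chosen because its members, evaluated at \<open>A\<close>, become
  \<open>raise_prod\<close>.\<close>

lemma newton_interpolation:
  fixes \<theta> z :: "nat \<Rightarrow> 'a::field"
  assumes "inj_on \<theta> {..d}"
  shows "\<exists>\<alpha>. \<forall>k\<le>d. z k = (\<Sum>t\<le>d. \<alpha> t * (\<Prod>j<t. \<theta> k - \<theta> j))"
  using assms
proof (induction d)
  case 0
  show ?case by (rule exI[of _ z]) simp
next
  case (Suc d)
  have "inj_on \<theta> {..d}" using Suc.prems by (rule inj_on_subset) auto
  then obtain \<alpha> where \<alpha>: "\<And>k. k \<le> d \<Longrightarrow> z k = (\<Sum>t\<le>d. \<alpha> t * (\<Prod>j<t. \<theta> k - \<theta> j))"
    using Suc.IH by blast
  define P where "P k = (\<Prod>j<Suc d. \<theta> k - \<theta> j)" for k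
  define S where "S k = (\<Sum>t\<le>d. \<alpha> t * (\<Prod>j<t. \<theta> k - \<theta> j))" for k
  define \<beta> where "\<beta> = \<alpha>(Suc d := (z (Suc d) - S (Suc d)) / P (Suc d))"
  have P0: "P k = 0" if "k \<le> d" for k using that unfolding P_def by (intro prod_zero bexI[of _ k]) auto
  have "\<theta> (Suc d) - \<theta> j \<noteq> 0" if "j < Suc d" for j
    using inj_onD[OF Suc.prems, of "Suc d" j] that by auto
  hence P1: "P (Suc d) \<noteq> 0" by (auto simp: P_def)
  have e: "(\<Sum>t\<le>Suc d. \<beta> t * (\<Prod>j<t. \<theta> k - \<theta> j)) = S k + \<beta> (Suc d) * P k" for k
    by (simp add: S_def P_def \<beta>_def)
  have "z k = (\<Sum>t\<le>Suc d. \<beta> t * (\<Prod>j<t. \<theta> k - \<theta> j))" if "k \<le> Suc d" for k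
  proof (cases "k = Suc d")
    case True
    thus ?thesis unfolding e using P1 by (simp add: \<beta>_def)
  next
    case False
    thus ?thesis unfolding e using that P0 \<alpha> by (simp add: S_def)
  qed
  thus ?case by blast
qed

text \<open>The first divided difference of \<open>g\<close> at neighbours \<open>x\<close>,
  \<open>y\<close> is \<open>x * y\<close>. Hence a second one equals its middle node, and the
  third, which is \<open>a\<close>, compares two middle nodes.\<close>

lemma cubic_divided_differences:
  fixes a b c e :: "'a::field"
  defines "g \<equiv> \<lambda>x. a * x ^ 3 + b * x ^ 2 + c * x + e"
  assumes eq: "g x0 - g x1 = x0 * x1 * (x0 - x1)" "g x1 - g x2 = x1 * x2 * (x1 - x2)"
      "g x2 - g x3 = x2 * x3 * (x2 - x3)"
    and ne: "x0 \<noteq> x1" "x1 \<noteq> x2" "x2 \<noteq> x3" "x0 \<noteq> x2" "x1 \<noteq> x3"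
  shows "a * (x0 - x3) = x1 - x2"
proof -
  have d1: "a * (x ^ 2 + x * y + y ^ 2) + b * (x + y) + c = x * y"
    if "g x - g y = x * y * (x - y)" "x \<noteq> y" for x y
  proof -
    have "(a * (x ^ 2 + x * y + y ^ 2) + b * (x + y) + c) * (x - y) = g x - g y"
      by (simp add: g_def algebra_simps power2_eq_square power3_eq_cube)
    thus ?thesis using that by simp
  qed
  have d2: "a * (x + y + z) + b = y"
    if "g x - g y = x * y * (x - y)" "g y - g z = y * z * (y - z)" "x \<noteq> y" "y \<noteq> z" "x \<noteq> z" for x y z
  proof -
    have "(a * (x + y + z) + b) * (x - z) = (a * (x ^ 2 + x * y + y ^ 2) + b * (x + y) + c) -
        (a * (y ^ 2 + y * z + z ^ 2) + b * (y + z) + c)"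
      by (simp add: algebra_simps power2_eq_square)
    also have "\<dots> = y * (x - z)" using d1[OF that(1,3)] d1[OF that(2,4)] by (simp add: algebra_simps)
    finally show ?thesis using that by simp
  qed
  have "a * (x0 + x1 + x2) + b - (a * (x1 + x2 + x3) + b) = x1 - x2"
    unfolding d2[OF eq(1,2) ne(1,2,4)] d2[OF eq(2,3) ne(2,3,5)] ..
  thus ?thesis by (simp add: algebra_simps)
qed

text \<open>In the inductive step \<open>(\<theta> 0 - \<theta> (Suc n)) + (x - \<theta> 0) = x -
  \<theta> (Suc n)\<close>. The right side is the Lagrange polynomial for the node
  \<open>\<theta> 0\<close>, the left side its Newton form.\<close>

lemma telescoping_products:
  fixes \<theta> :: "nat \<Rightarrow> 'a::field"
  assumes "\<And>j. 1 \<le> j \<Longrightarrow> j \<le> n \<Longrightarrow> \<theta> 0 \<noteq> \<theta> j"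
  shows "(\<Sum>h\<le>n. (\<Prod>j<h. x - \<theta> j) / (\<Prod>j=1..h. \<theta> 0 - \<theta> j)) =
    (\<Prod>j=1..n. x - \<theta> j) / (\<Prod>j=1..n. \<theta> 0 - \<theta> j)"
  using assms
proof (induction n)
  case (Suc n)
  define P where "P = (\<Prod>j=1..n. x - \<theta> j)"
  define Q where "Q = (\<Prod>j=1..n. \<theta> 0 - \<theta> j)"
  have Q: "Q \<noteq> 0" using Suc.prems by (auto simp: Q_def)
  have t: "\<theta> 0 - \<theta> (Suc n) \<noteq> 0" using Suc.prems by auto
  have "(\<Prod>j<Suc n. x - \<theta> j) = (x - \<theta> 0) * P"
    unfolding P_def by (subst prod.lessThan_Suc_shift) (simp add: prod.atLeast1_atMost_eq)
  hence "(\<Sum>h\<le>Suc n. (\<Prod>j<h. x - \<theta> j) / (\<Prod>j=1..h. \<theta> 0 - \<theta> j)) =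
      P / Q + (x - \<theta> 0) * P / (Q * (\<theta> 0 - \<theta> (Suc n)))"
    using Suc by (simp add: P_def Q_def del: prod.lessThan_Suc)
  also have "\<dots> = P * (x - \<theta> (Suc n)) / (Q * (\<theta> 0 - \<theta> (Suc n)))"
    using Q t by (simp add: divide_simps) (simp add: algebra_simps)
  finally show ?case by (simp add: P_def Q_def)
qed simp

lemma recurrent_reverse:
  assumes "recurrent d c \<theta>"
  shows "recurrent d c (\<lambda>i. \<theta> (d - i))"
  unfolding recurrent_def
proof (intro allI impI)
  fix i assume i: "i + 3 \<le> d"
  define k where "k = d - (i + 3)"
  have "\<theta> k - \<theta> (k + 3) = c * (\<theta> (k + 1) - \<theta> (k + 2))"
    by (rule assms[unfolded recurrent_def, rule_format]) (use i in \<open>simp add: k_def\<close>)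
  moreover have "d - i = k + 3" "d - (i + 1) = k + 2" "d - (i + 2) = k + 1" "d - (i + 3) = k"
    using i by (auto simp: k_def)
  ultimately show "\<theta> (d - i) - \<theta> (d - (i + 3)) = c * (\<theta> (d - (i + 1)) - \<theta> (d - (i + 2)))"
    by (metis minus_diff_eq mult_minus_right)
qed

text \<open>Distinct values make the denominators nonzero, and \<open>3 \<le> d\<close> makes the
  index range nonempty, so that the described constant is unique.\<close>

lemma common_ratio_eq:
  assumes "3 \<le> d" and inj: "inj_on \<theta> {..d}" "inj_on \<theta>s {..d}"
    and rec: "recurrent d c \<theta>" "recurrent d c \<theta>s"
  shows "common_ratio d \<theta> \<theta>s = c"
proof -
  have r: "(f (i - 2) - f (i + 1)) / (f (i - 1) - f i) = c"
    if "i \<in> {2..d - 1}" "recurrent d c f" "inj_on f {..d}" for i and f :: "nat \<Rightarrow> 'a"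
  proof -
    define j where "j = i - 2"
    have j: "i = j + 2" using that(1) unfolding j_def atLeastAtMost_iff by linarith
    have jd: "j + 3 \<le> d" using that(1) j assms(1) by auto
    have "f (j + 1) \<noteq> f (j + 2)" using inj_onD[OF that(3), of "j + 1" "j + 2"] jd by auto
    moreover have "f j - f (j + 3) = c * (f (j + 1) - f (j + 2))"
      using that(2) jd by (simp add: recurrent_def)
    ultimately show ?thesis using j by (simp add: numeral_3_eq_3)
  qed
  show ?thesis
    unfolding common_ratio_def
  proof (rule the_equality)
    show "\<forall>i\<in>{2..d - 1}. (\<theta> (i - 2) - \<theta> (i + 1)) / (\<theta> (i - 1) - \<theta> i) = c \<and>
        (\<theta>s (i - 2) - \<theta>s (i + 1)) / (\<theta>s (i - 1) - \<theta>s i) = c"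
      using r inj rec by blast
    fix c'
    assume c': "\<forall>i\<in>{2..d - 1}. (\<theta> (i - 2) - \<theta> (i + 1)) / (\<theta> (i - 1) - \<theta> i) = c' \<and>
        (\<theta>s (i - 2) - \<theta>s (i + 1)) / (\<theta>s (i - 1) - \<theta>s i) = c'"
    have m: "2 \<in> {2..d - 1}" using assms(1) by auto
    show "c' = c" using bspec[OF c' m] r[OF m rec(1) inj(1)] by simp
  qed
qed

section \<open>Tridiagonal systems\<close>

locale spectral = pos_fin_dim_vector_space scale Basis
  for scale :: "'a::field \<Rightarrow> 'b::ab_group_add \<Rightarrow> 'b" (infixr "*s" 75) and Basis :: "'b set" +
  fixes d :: nat and A :: "'b \<Rightarrow> 'b" and E :: "nat \<Rightarrow> 'b \<Rightarrow> 'b"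
  assumes lin_A: "Vector_Spaces.linear scale scale A"
    and lin_E: "i \<le> d \<Longrightarrow> Vector_Spaces.linear scale scale (E i)"
    and A_E: "i \<le> d \<Longrightarrow> A (E i v) = eigenvalue_seq A E i *s E i v"
    and E_E: "i \<le> d \<Longrightarrow> j \<le> d \<Longrightarrow> E i (E j v) = (if i = j then E j v else 0)"
    and E_sum: "(\<Sum>i\<le>d. E i v) = v"
    and inj_ev: "inj_on (eigenvalue_seq A E) {..d}"
    and E_nonzero: "i \<le> d \<Longrightarrow> \<exists>v. E i v \<noteq> 0"
begin

abbreviation "th \<equiv> eigenvalue_seq A E"

sublocale A: Vector_Spaces.linear scale scale A by (rule lin_A)

lemma
  assumes "i \<le> d"
  shows E_add: "E i (v + w) = E i v + E i w"
    and E_diff: "E i (v - w) = E i v - E i w"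
    and E_scale: "E i (c *s v) = c *s E i v"
    and E_0: "E i 0 = 0"
    and E_setsum: "E i (sum f S) = (\<Sum>x\<in>S. E i (f x))"
proof -
  interpret Ei: Vector_Spaces.linear scale scale "E i" by (rule lin_E[OF assms])
  show "E i (v + w) = E i v + E i w" "E i (v - w) = E i v - E i w" "E i (c *s v) = c *s E i v"
    "E i 0 = 0" "E i (sum f S) = (\<Sum>x\<in>S. E i (f x))"
    by (rule Ei.add Ei.diff Ei.scale Ei.zero Ei.sum)+
qed

lemmas E_simps = E_add E_diff E_scale E_0 E_setsum

text \<open>Identities between polynomials in \<open>A\<close> are proved through this: on the range
  of \<open>E i\<close> such a polynomial acts as its value at \<open>th i\<close>.\<close>

lemma eqI: "(\<And>i. i \<le> d \<Longrightarrow> E i v = E i w) \<Longrightarrow> v = w"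
  using E_sum[of v] E_sum[of w] by (metis (no_types, lifting) atMost_iff sum.cong)

lemma E_idem: "i \<le> d \<Longrightarrow> E i (E i v) = E i v"
  by (simp add: E_E)

lemma in_range_E: "i \<le> d \<Longrightarrow> v \<in> range (E i) \<longleftrightarrow> E i v = v"
  using E_idem by (metis rangeE rangeI)

lemma E_A:
  assumes "i \<le> d"
  shows "E i (A v) = th i *s E i v"
proof -
  have "E i (A v) = (\<Sum>j\<le>d. E i (A (E j v)))"
    by (subst E_sum[of v, symmetric]) (simp only: A.sum E_setsum[OF assms])
  also have "\<dots> = (\<Sum>j\<le>d. if i = j then th i *s E i v else 0)"
    by (rule sum.cong) (auto simp: A_E E_scale assms E_E)
  also have "\<dots> = th i *s E i v" using assms by simp
  finally show ?thesis .
qed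

lemma E_raise_prod:
  assumes "k \<le> d"
  shows "E k (raise_prod A x i v) = (\<Prod>j<i. th k - x j) *s E k v"
  by (induction i)
    (simp_all add: assms E_simps E_A left_diff_distrib mult_ac flip: scale_left_diff_distrib)

lemma E_lower_prod:
  assumes "k \<le> d"
  shows "E k (lower_prod A x i v) = (\<Prod>j=1..i. th k - x j) *s E k v"
  by (induction i arbitrary: v)
    (simp_all add: assms E_simps E_A left_diff_distrib mult_ac flip: scale_left_diff_distrib)

text \<open>Polynomials in one map commute. The raising form makes the lemmas on
  \<open>raise_prod\<close> available for lowering products.\<close>

lemma lower_prod_eq_raise_prod: "lower_prod A x i v = raise_prod A (\<lambda>j. x (i - j)) i v"
proof (rule eqI)
  fix k assume "k \<le> d"
  have "(\<Prod>j=1..i. th k - x j) = (\<Prod>j<i. th k - x (i - j))"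
    by (rule prod.reindex_bij_witness[of _ "\<lambda>j. i - j" "\<lambda>j. i - j"]) auto
  thus "E k (lower_prod A x i v) = E k (raise_prod A (\<lambda>j. x (i - j)) i v)"
    using \<open>k \<le> d\<close> by (simp add: E_raise_prod E_lower_prod)
qed

lemma
  shows raise_prod_add: "raise_prod A x i (v + w) = raise_prod A x i v + raise_prod A x i w"
    and raise_prod_scale: "raise_prod A x i (c *s v) = c *s raise_prod A x i v"
  by (rule eqI; simp add: E_simps E_raise_prod algebra_simps)+

lemma raise_prod_sum: "raise_prod A x i (sum f S) = (\<Sum>s\<in>S. raise_prod A x i (f s))"
  by (rule eqI) (simp add: E_simps E_raise_prod scale_sum_right)

lemma raise_prod_expansion:
  assumes "(\<Prod>j<i. [:- y j, 1:]) = (\<Sum>h\<in>S. smult (c h) (\<Prod>j<h. [:- x j, 1:]))"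
  shows "raise_prod A y i v = (\<Sum>h\<in>S. c h *s raise_prod A x h v)"
proof (rule eqI)
  fix k assume k: "k \<le> d"
  have "poly (\<Prod>j<i. [:- y j, 1:]) (th k) = poly (\<Sum>h\<in>S. smult (c h) (\<Prod>j<h. [:- x j, 1:])) (th k)"
    by (simp only: assms)
  hence "(\<Prod>j<i. th k - y j) = (\<Sum>h\<in>S. c h * (\<Prod>j<h. th k - x j))"
    by (simp add: poly_prod poly_sum)
  thus "E k (raise_prod A y i v) = E k (\<Sum>h\<in>S. c h *s raise_prod A x h v)"
    using k by (simp add: E_simps E_raise_prod scale_sum_left)
qed

text \<open>The bound is strict: \<open>below i\<close> is the sum of the ranges of
  \<open>E 0\<close> to \<open>E (i - 1)\<close>, and \<open>below 0\<close> is zero, while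
  \<open>above i\<close> below is the sum of those of \<open>E i\<close> to \<open>E d\<close>. The
  split space of index \<open>i\<close> is thus
  \<open>star.below (Suc i) \<inter> above i\<close>.\<close>

definition below :: "nat \<Rightarrow> 'b set" where
  "below i = {v. \<forall>k\<le>d. i \<le> k \<longrightarrow> E k v = 0}"

definition above :: "nat \<Rightarrow> 'b set" where
  "above i = {v. \<forall>k\<le>d. k < i \<longrightarrow> E k v = 0}"

lemma
  shows below_diff: "v \<in> below i \<Longrightarrow> w \<in> below i \<Longrightarrow> v - w \<in> below i"
    and below_scale: "v \<in> below i \<Longrightarrow> c *s v \<in> below i"
    and below_mono: "v \<in> below i \<Longrightarrow> i \<le> j \<Longrightarrow> v \<in> below j"
    and belowD: "v \<in> below i \<Longrightarrow> i \<le> k \<Longrightarrow> k \<le> d \<Longrightarrow> E k v = 0"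
  by (auto simp: below_def E_simps)

lemma
  shows above_diff: "v \<in> above i \<Longrightarrow> w \<in> above i \<Longrightarrow> v - w \<in> above i"
    and above_scale: "v \<in> above i \<Longrightarrow> c *s v \<in> above i"
    and above_mono: "v \<in> above i \<Longrightarrow> j \<le> i \<Longrightarrow> v \<in> above j"
    and aboveD: "v \<in> above i \<Longrightarrow> k < i \<Longrightarrow> k \<le> d \<Longrightarrow> E k v = 0"
  by (auto simp: above_def E_simps)

lemma below_0: "v \<in> below 0 \<Longrightarrow> v = 0"
  by (rule eqI) (simp add: below_def E_simps)

lemma below_Suc_0: "v \<in> below (Suc 0) \<longleftrightarrow> v \<in> range (E 0)"
proof
  assume "v \<in> below (Suc 0)"
  hence "E k v = E k (E 0 v)" if "k \<le> d" for k
    using that by (cases k) (auto simp: below_def E_E)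
  hence "v = E 0 v" by (rule eqI)
  thus "v \<in> range (E 0)" by (metis rangeI)
qed (auto simp: below_def E_E)

lemma below_A: "v \<in> below i \<Longrightarrow> A v \<in> below i"
  by (simp add: below_def E_A)

lemma below_lower: "v \<in> below (Suc i) \<Longrightarrow> A v - th i *s v \<in> below i"
  by (auto simp: below_def E_A E_simps le_eq_less_or_eq simp flip: scale_left_diff_distrib)

lemma above_raise: "v \<in> above i \<Longrightarrow> A v - th i *s v \<in> above (Suc i)"
  by (auto simp: above_def E_A E_simps less_Suc_eq simp flip: scale_left_diff_distrib)

lemma raise_prod_above: "raise_prod A th i v \<in> above i"
  by (auto simp: above_def E_raise_prod)

end

text \<open>Tridiagonality is stated through vanishing blocks, a form that survives exchange of the
  two maps and reversal of either ordering.\<close>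

locale td_system = spectral scale Basis d A E + star: spectral scale Basis d As Es
  for scale :: "'a::field \<Rightarrow> 'b::ab_group_add \<Rightarrow> 'b" (infixr "*s" 75) and Basis :: "'b set"
    and d A E As Es +
  assumes E_As_E: "i \<le> d \<Longrightarrow> j \<le> d \<Longrightarrow> i + 1 < j \<or> j + 1 < i \<Longrightarrow> E i (As (E j v)) = 0"
    and Es_A_Es: "i \<le> d \<Longrightarrow> j \<le> d \<Longrightarrow> i + 1 < j \<or> j + 1 < i \<Longrightarrow> Es i (A (Es j v)) = 0"
    and irreducible: "subspace W \<Longrightarrow> A ` W \<subseteq> W \<Longrightarrow> As ` W \<subseteq> W \<Longrightarrow> W = {0} \<or> W = UNIV"
begin

section \<open>Action of each map on the partial sums of eigenspaces of the other\<close>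

lemma Es_A:
  assumes "k \<le> d"
  shows "Es k (A v) = (\<Sum>l\<le>d. Es k (A (Es l v)))"
  by (subst star.E_sum[of v, symmetric]) (simp only: A.sum star.E_setsum[OF assms])

lemma E_As:
  assumes "k \<le> d"
  shows "E k (As v) = (\<Sum>l\<le>d. E k (As (E l v)))"
  by (subst E_sum[of v, symmetric]) (simp only: star.A.sum E_setsum[OF assms])

lemma A_below:
  assumes "v \<in> star.below i"
  shows "A v \<in> star.below (Suc i)"
  unfolding star.below_def
proof (intro CollectI allI impI)
  fix k assume k: "k \<le> d" "Suc i \<le> k"
  have "Es k (A (Es l v)) = 0" if "l \<le> d" for l
    using that k assms Es_A_Es[of k l v]
    by (cases "l < i") (auto simp: star.belowD A.zero star.E_0)
  thus "Es k (A v) = 0" by (subst Es_A) (simp_all add: k)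
qed

lemma As_above:
  assumes "v \<in> above (Suc i)"
  shows "As v \<in> above i"
  unfolding above_def
proof (intro CollectI allI impI)
  fix k assume k: "k \<le> d" "k < i"
  have "E k (As (E l v)) = 0" if "l \<le> d" for l
    using that k assms E_As_E[of k l v]
    by (cases "l < Suc i") (auto simp: aboveD star.A.zero E_0)
  thus "E k (As v) = 0" by (subst E_As) (simp_all add: k)
qed

lemma raise_prod_below: "v \<in> star.below m \<Longrightarrow> raise_prod A x i v \<in> star.below (m + i)"
proof (induction i)
  case (Suc i)
  hence "raise_prod A x i v \<in> star.below (m + i)" by simp
  thus ?case
    by (simp add: star.below_diff A_below star.below_scale star.below_mono[of _ "m + i"])
qed simp

text \<open>A polynomial in \<open>A\<close> of degree less than \<open>i\<close> sends
  \<open>star.below (Suc m)\<close> into \<open>star.below (m + i)\<close>, which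
  \<open>Es k\<close> kills. Only the leading term counts, so the roots are immaterial.\<close>

lemma Es_raise_prod_top:
  assumes "v \<in> star.below (Suc m)" and "k \<le> d" and "m + i \<le> k"
  shows "Es k (raise_prod A x i v) = Es k (raise_prod A y i v)"
  using assms(2,3)
proof (induction i arbitrary: k)
  case (Suc i)
  have b: "Es k (raise_prod A z i v) = 0" for z :: "nat \<Rightarrow> 'a"
    by (rule star.belowD[OF raise_prod_below[OF assms(1)]]) (use Suc.prems in simp_all)
  have "Es k (A (Es l (raise_prod A x i v))) = Es k (A (Es l (raise_prod A y i v)))" if "l \<le> d" for l
  proof (cases "l + 1 < k")
    case True
    thus ?thesis using Es_A_Es that Suc.prems by simp
  next
    case False
    thus ?thesis using Suc.IH[of l] Suc.prems that by simp
  qed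
  hence "Es k (A (raise_prod A x i v)) = Es k (A (raise_prod A y i v))"
    using Suc.prems by (subst (1 2) Es_A) simp_all
  thus ?case using b Suc.prems by (simp add: star.E_simps)
qed simp

text \<open>The sum of the spaces \<open>below i \<inter> above i\<close> is invariant under both maps and \<open>E 0\<close> vanishes on it,
  so irreducibility forces it to be zero.\<close>

lemma below_above:
  assumes "v \<in> star.below i" and "v \<in> above i"
  shows "v = 0"
proof -
  define S where "S = (\<Union>i. star.below i \<inter> above i)"
  define W where "W = span S"
  have W: "subspace W" by (simp add: W_def)
  have S: "A x \<in> W \<and> As x \<in> W" if "x \<in> S" for x
  proof -
    obtain i where x: "x \<in> star.below i" "x \<in> above i" using \<open>x \<in> S\<close> unfolding S_def by blast
    have xW: "x \<in> W" using that by (simp add: W_def span_base)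
    \<comment> \<open>The index of a generator goes up by one under \<open>A - th i\<close> and,
      further on, down by one under \<open>As - star.th j\<close> with
      \<open>i = Suc j\<close>.\<close>
    have "A x - th i *s x \<in> star.below (Suc i) \<inter> above (Suc i)"
      using x by (simp add: above_raise A_below star.below_scale star.below_diff star.below_mono[of _ i])
    hence "A x - th i *s x \<in> W" by (auto simp: W_def S_def intro!: span_base)
    hence "(A x - th i *s x) + th i *s x \<in> W"
      using W xW by (intro subspace_add subspace_scale)
    hence A: "A x \<in> W" by simp
    have "As x \<in> W"
    proof (cases i)
      case 0
      hence "x = 0" using x star.below_0 by blast
      thus ?thesis using W by (simp add: star.A.zero subspace_0)
    next
      case (Suc j)
      have "As x - star.th j *s x \<in> star.below j \<inter> above j"
        using x by (simp add: Suc star.below_lower As_above above_scale above_diff above_mono[of _ "Suc j"])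
      hence "As x - star.th j *s x \<in> W" by (auto simp: W_def S_def intro!: span_base)
      hence "(As x - star.th j *s x) + star.th j *s x \<in> W"
        using W xW by (intro subspace_add subspace_scale)
      thus ?thesis by simp
    qed
    thus ?thesis using A by simp
  qed
  have "A x \<in> W \<and> As x \<in> W" if "x \<in> W" for x
    using that unfolding W_def
  proof (induction rule: span_induct)
    case base
    show ?case
      by (rule subspaceI)
        (auto simp: A.zero star.A.zero A.add star.A.add A.scale star.A.scale
          intro: span_zero span_add span_scale)
  next
    case (step x)
    thus ?case using S by (simp add: W_def)
  qed
  hence "W = {0} \<or> W = UNIV" using irreducible[OF W] by blast
  moreover have "W \<subseteq> {x. E 0 x = 0}"
  proof -
    have "S \<subseteq> {x. E 0 x = 0}"
    proof
      fix x assume "x \<in> S"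
      then obtain i where x: "x \<in> star.below i" "x \<in> above i" unfolding S_def by blast
      show "x \<in> {x. E 0 x = 0}"
        using x aboveD[of x i 0] star.below_0[of x] by (cases i) (auto simp: E_0)
    qed
    moreover have "subspace {x. E 0 x = 0}" by (rule subspaceI) (auto simp: E_simps)
    ultimately show ?thesis unfolding W_def by (rule span_minimal)
  qed
  moreover obtain w where "E 0 w \<noteq> 0" using E_nonzero[of 0] by blast
  ultimately have "W = {0}" by blast
  moreover have "v \<in> W" using assms by (auto simp: W_def S_def intro!: span_base)
  ultimately show ?thesis by blast
qed

lemma E_0_inj:
  assumes "u \<in> range (Es 0)" and "E 0 u = 0"
  shows "u = 0"
proof (rule below_above)
  show "u \<in> star.below (Suc 0)" using assms star.below_Suc_0 by blast
  show "u \<in> above (Suc 0)" using assms by (simp add: above_def)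
qed

end

section \<open>Reversed and dual systems\<close>

lemma eigenvalue_seq_comp:
  assumes "pos_fin_dim_vector_space scale Basis"
  shows "pos_fin_dim_vector_space.eigenvalue_seq scale A (\<lambda>i. E (f i)) =
    (\<lambda>i. pos_fin_dim_vector_space.eigenvalue_seq scale A E (f i))"
  by (simp add: fun_eq_iff pos_fin_dim_vector_space.eigenvalue_seq_def[OF assms])

lemma td_system_dual: "td_system scale Basis d A E As Es \<Longrightarrow> td_system scale Basis d As Es A E"
  unfolding td_system_def td_system_axioms_def by blast

lemma spectral_reverse:
  assumes "spectral scale Basis d A E"
  shows "spectral scale Basis d A (\<lambda>i. E (d - i))"
proof -
  interpret spectral scale Basis d A E by fact
  note c = eigenvalue_seq_comp[OF pos_fin_dim_vector_space_axioms]
  show ?thesis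
  proof (intro spectral.intro spectral_axioms.intro pos_fin_dim_vector_space_axioms)
    show "(\<Sum>i\<le>d. E (d - i) v) = v" for v
      using E_sum[of v] sum.nat_diff_reindex[of "\<lambda>i. E i v" "Suc d"] by (simp only: lessThan_Suc_atMost diff_Suc_Suc)
    show "inj_on (eigenvalue_seq A (\<lambda>i. E (d - i))) {..d}"
      using inj_ev unfolding c inj_on_def by (auto simp: Ball_def) (metis diff_diff_cancel diff_le_self)
    show "\<exists>v. E (d - i) v \<noteq> 0" for i by (rule E_nonzero) simp
    show "E (d - i) (E (d - j) v) = (if i = j then E (d - j) v else 0)" if "i \<le> d" "j \<le> d" for i j v
      using that by (auto simp: E_E)
    show "Vector_Spaces.linear scale scale (E (d - i))" for i by (rule lin_E) simp
    show "A (E (d - i) v) = scale (eigenvalue_seq A (\<lambda>i. E (d - i)) i) (E (d - i) v)" for i v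
      unfolding c by (rule A_E) simp
  qed (rule lin_A)
qed

lemma td_system_reverse:
  assumes "td_system scale Basis d A E As Es"
  shows "td_system scale Basis d A (\<lambda>i. E (d - i)) As Es"
proof -
  interpret td_system scale Basis d A E As Es by fact
  show ?thesis
  proof (intro td_system.intro td_system_axioms.intro)
    show "spectral scale Basis d A (\<lambda>i. E (d - i))"
      by (rule spectral_reverse) unfold_locales
    show "spectral scale Basis d As Es" by unfold_locales
    show "E (d - i) (As (E (d - j) v)) = 0" if "i \<le> d" "j \<le> d" "i + 1 < j \<or> j + 1 < i" for i j v
      by (rule E_As_E) (use that in auto)
  qed (fact Es_A_Es irreducible)+
qed

section \<open>Split sequences and recurrence of the eigenvalues\<close>

context pos_fin_dim_vector_space
begin

definition line :: "'b set \<Rightarrow> bool" where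
  "line S \<longleftrightarrow> (\<exists>e. e \<noteq> 0 \<and> e \<in> S \<and> (\<forall>v\<in>S. \<exists>c. v = scale c e))"

lemma lineE:
  assumes "line S"
  obtains e where "e \<noteq> 0" "e \<in> S" "\<And>v. v \<in> S \<Longrightarrow> \<exists>c. v = scale c e"
  using assms unfolding line_def by blast

lemma line_if_dim_1:
  assumes "subspace S" and "dim S = 1"
  shows "line S"
proof -
  obtain B where B: "B \<subseteq> S" "independent B" "S \<subseteq> span B" "card B = dim S"
    using basis_exists by blast
  obtain e where e: "B = {e}" using B(4) assms(2) by (metis card_1_singletonE)
  have "e \<noteq> 0" using B(2) e dependent_zero by blast
  moreover have "\<exists>c. v = scale c e" if "v \<in> S" for v
    using B(3) e that by (auto simp: span_singleton)
  ultimately show ?thesis using B(1) e unfolding line_def by auto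
qed

lemma eigenvalue_on_eq:
  assumes "u \<in> S" "u \<noteq> 0" and "\<And>v. v \<in> S \<Longrightarrow> f v = scale c v"
  shows "eigenvalue_on f S = c"
  unfolding eigenvalue_on_def
proof (rule the_equality)
  show "\<forall>v\<in>S. f v = scale c v" using assms(3) by blast
  fix c' assume "\<forall>v\<in>S. f v = scale c' v"
  thus "c' = c" using assms by (metis scale_right_imp_eq)
qed

end

context spectral
begin

lemma subspace_range_E: "i \<le> d \<Longrightarrow> subspace (range (E i))"
  by (rule subspaceI) (auto simp: in_range_E E_simps)

lemma ev_eq_iff: "i \<le> d \<Longrightarrow> j \<le> d \<Longrightarrow> th i = th j \<longleftrightarrow> i = j"
  using inj_ev by (simp add: inj_on_eq_iff)

lemma span_ranges_E: "span (\<Union>j\<in>{0..d}. range (E j)) = UNIV"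
proof -
  have "(\<Sum>i\<le>d. E i v) \<in> span (\<Union>j\<in>{0..d}. range (E j))" for v
    by (intro span_sum span_base UN_I rangeI) auto
  thus ?thesis unfolding E_sum by blast
qed

text \<open>Applying \<open>F\<close> to \<open>raise_prod_expansion\<close> at \<open>e\<close> and
  comparing multiples of \<open>e\<close> turns a polynomial identity into one between scalars.
  Later \<open>F\<close> is a primitive idempotent of the other map.\<close>

lemma raise_prod_scalars_expansion:
  assumes F: "Vector_Spaces.linear scale scale F" and "e \<noteq> 0"
    and b: "F (raise_prod A y i e) = b *s e" and a: "\<And>h. h \<in> S \<Longrightarrow> F (raise_prod A x h e) = a h *s e"
    and "(\<Prod>j<i. [:- y j, 1:]) = (\<Sum>h\<in>S. smult (c h) (\<Prod>j<h. [:- x j, 1:]))"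
  shows "b = (\<Sum>h\<in>S. c h * a h)"
proof -
  interpret F: Vector_Spaces.linear scale scale F by (rule F)
  have "b *s e = (\<Sum>h\<in>S. c h * a h) *s e"
    unfolding b[symmetric] raise_prod_expansion[OF assms(5)]
    by (simp add: F.sum F.scale a scale_sum_left)
  thus ?thesis using \<open>e \<noteq> 0\<close> by simp
qed

end

section \<open>The split sequence as a component of a product applied to a vector\<close>

context td_system
begin

text \<open>By \<open>E_0_inj\<close> the map \<open>E 0\<close> embeds the range of
  \<open>Es 0\<close> into the line \<open>range (E 0)\<close>, so any nonzero vector of the smaller
  range spans it.\<close>

lemma line_range_Es:
  assumes "line (range (E 0))"
  shows "line (range (Es 0))"
proof -
  obtain e where e: "e \<noteq> 0" "\<And>v. v \<in> range (E 0) \<Longrightarrow> \<exists>c. v = c *s e"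
    using assms by (rule lineE) blast
  obtain w where w: "Es 0 w \<noteq> 0" using star.E_nonzero[of 0] by blast
  define u where "u = Es 0 w"
  have u: "u \<in> range (Es 0)" "u \<noteq> 0" using w by (auto simp: u_def)
  obtain a where a: "E 0 u = a *s e" using e(2)[of "E 0 u"] by blast
  have a0: "a \<noteq> 0" using a E_0_inj[OF u(1)] u(2) by auto
  have "\<exists>c. v = c *s u" if v: "v \<in> range (Es 0)" for v
  proof -
    obtain b where b: "E 0 v = b *s e" using e(2)[of "E 0 v"] by blast
    have "v - (b / a) *s u \<in> range (Es 0)"
      using v u(1) by (auto intro!: subspace_diff subspace_scale star.subspace_range_E)
    moreover have "E 0 (v - (b / a) *s u) = 0" using a0 by (simp add: E_simps a b)
    ultimately have "v - (b / a) *s u = 0" by (rule E_0_inj)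
    thus ?thesis by auto
  qed
  thus ?thesis using u unfolding line_def by blast
qed

lemma split_space_0: "split_space d E Es 0 = range (Es 0)"
  using star.subspace_range_E[of 0] by (simp add: split_space_def span_ranges_E span_eq_iff)

text \<open>The raised vector has components of index 0 to \<open>i\<close> only. The lowering
  product kills those of index 1 to \<open>i\<close> and acts on the remaining one by a
  scalar.\<close>

lemma lower_raise:
  assumes u: "u \<in> range (Es 0)"
  shows "lower_prod As star.th i (raise_prod A x i u) =
    (\<Prod>j=1..i. star.th 0 - star.th j) *s Es 0 (raise_prod A x i u)"
proof (rule star.eqI)
  fix k assume k: "k \<le> d"
  have b: "raise_prod A x i u \<in> star.below (Suc i)"
    using raise_prod_below[of u "Suc 0" x i] u star.below_Suc_0 by simp
  consider "k = 0" | "1 \<le> k" "k \<le> i" | "Suc i \<le> k" by linarith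
  thus "Es k (lower_prod As star.th i (raise_prod A x i u)) =
      Es k ((\<Prod>j=1..i. star.th 0 - star.th j) *s Es 0 (raise_prod A x i u))"
  proof cases
    case 2
    hence "(\<Prod>j=1..i. star.th k - star.th j) = 0" by (intro prod_zero bexI[of _ k]) auto
    thus ?thesis using k 2 by (simp add: star.E_lower_prod star.E_simps star.E_E)
  next
    case 3
    thus ?thesis using k star.belowD[OF b] by (simp add: star.E_lower_prod star.E_simps star.E_E)
  qed (simp add: star.E_lower_prod star.E_simps star.E_E)
qed

text \<open>The composite maps a line into itself, so it acts there by a scalar, and the nonzero
  vector makes the description in \<open>split_seq\<close> unique.\<close>

lemma lower_raise_split_seq:
  assumes line: "line (range (Es 0))" and u: "u \<in> range (Es 0)"
  shows "lower_prod As star.th i (raise_prod A th i u) = split_seq d A E As Es i *s u"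
proof -
  define f where "f = lower_prod As star.th i \<circ> raise_prod A th i"
  obtain e where e: "e \<noteq> 0" "e \<in> range (Es 0)" "\<And>v. v \<in> range (Es 0) \<Longrightarrow> \<exists>c. v = c *s e"
    using line by (rule lineE) blast
  have "f e \<in> range (Es 0)"
    by (simp add: f_def lower_raise[OF e(2)] subspace_scale star.subspace_range_E)
  then obtain c where c: "f e = c *s e" using e(3) by blast
  have f: "f v = c *s v" if "v \<in> range (Es 0)" for v
  proof -
    obtain b where b: "v = b *s e" using e(3) \<open>v \<in> range (Es 0)\<close> by blast
    have "f v = b *s f e"
      by (simp add: f_def b raise_prod_scale star.lower_prod_eq_raise_prod star.raise_prod_scale)
    thus ?thesis by (simp add: c b mult.commute)
  qed
  have "split_seq d A E As Es i = c"
    unfolding split_seq_def split_space_0 f_def[symmetric]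
    by (rule eigenvalue_on_eq[OF e(2,1) f])
  thus ?thesis using f[OF u] by (simp add: f_def)
qed

lemma prod_star_th_nonzero: "i \<le> d \<Longrightarrow> (\<Prod>j=1..i. star.th 0 - star.th j) \<noteq> 0"
  by (auto simp: star.ev_eq_iff)

lemma prod_th_nonzero: "i \<le> d \<Longrightarrow> (\<Prod>j=1..i. th 0 - th j) \<noteq> 0"
  by (auto simp: ev_eq_iff)

lemma Es_0_raise_prod:
  assumes line: "line (range (Es 0))" and u: "u \<in> range (Es 0)" and i: "i \<le> d"
  shows "Es 0 (raise_prod A th i u) =
    (split_seq d A E As Es i / (\<Prod>j=1..i. star.th 0 - star.th j)) *s u"
proof -
  define p where "p = (\<Prod>j=1..i. star.th 0 - star.th j)"
  have p: "p \<noteq> 0" unfolding p_def by (rule prod_star_th_nonzero[OF i])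
  have "p *s Es 0 (raise_prod A th i u) = split_seq d A E As Es i *s u"
    using lower_raise[OF u] lower_raise_split_seq[OF line u] by (simp add: p_def)
  hence "(1 / p) *s (p *s Es 0 (raise_prod A th i u)) = (1 / p) *s (split_seq d A E As Es i *s u)"
    by simp
  thus ?thesis unfolding p_def[symmetric] using p by simp
qed

lemma raise_prod_As_above: "v \<in> above (m + i) \<Longrightarrow> raise_prod As x i v \<in> above m"
proof (induction i arbitrary: m)
  case (Suc i)
  hence "raise_prod As x i v \<in> above (Suc m)" by simp
  thus ?case by (simp add: above_diff As_above above_scale above_mono[of _ "Suc m"])
qed simp

text \<open>Mirror image of \<open>Es_raise_prod_top\<close>: since \<open>As\<close> lowers
  \<open>above\<close> by at most one, the component of index \<open>k\<close> sees only the leading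
  term.\<close>

lemma E_raise_prod_As_bottom:
  assumes "v \<in> above m" and "k \<le> d" and "k + i \<le> m"
  shows "E k (raise_prod As x i v) = E k (raise_prod As y i v)"
  using assms(2,3)
proof (induction i arbitrary: k)
  case (Suc i)
  have b: "E k (raise_prod As z i v) = 0" for z :: "nat \<Rightarrow> 'a"
    by (rule aboveD[OF raise_prod_As_above[of _ "Suc k"]])
      (use Suc.prems above_mono[OF assms(1)] in simp_all)
  have "E k (As (E l (raise_prod As x i v))) = E k (As (E l (raise_prod As y i v)))" if "l \<le> d" for l
  proof (cases "k + 1 < l")
    case True
    thus ?thesis using E_As_E that Suc.prems by simp
  next
    case False
    thus ?thesis using Suc.IH[of l] Suc.prems that by simp
  qed
  hence "E k (As (raise_prod As x i v)) = E k (As (raise_prod As y i v))"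
    using Suc.prems by (subst (1 2) E_As) simp_all
  thus ?case using b Suc.prems by (simp add: E_simps)
qed simp

lemma raise_prod_As_eq_0:
  assumes "v \<in> star.below i"
  shows "raise_prod As star.th i v = 0"
proof (rule star.eqI)
  fix k assume k: "k \<le> d"
  have "(\<Prod>j<i. star.th k - star.th j) = 0 \<or> Es k v = 0"
    using star.belowD[OF assms _ k] by (cases "k < i") auto
  thus "Es k (raise_prod As star.th i v) = Es k 0"
    using k by (auto simp: star.E_raise_prod star.E_simps)
qed

text \<open>The idempotent \<open>E 0\<close> is a Lagrange polynomial evaluated at
  \<open>A\<close>, and \<open>telescoping_products\<close> gives its Newton form.\<close>

lemma E_0_eq_sum_raise_prod:
  "E 0 u = (\<Sum>h\<le>d. (1 / (\<Prod>j=1..h. th 0 - th j)) *s raise_prod A th h u)"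
proof (rule eqI)
  fix k assume k: "k \<le> d"
  have "(\<Sum>h\<le>d. (\<Prod>j<h. th k - th j) / (\<Prod>j=1..h. th 0 - th j)) =
      (\<Prod>j=1..d. th k - th j) / (\<Prod>j=1..d. th 0 - th j)"
    by (rule telescoping_products) (auto simp: ev_eq_iff)
  also have "\<dots> = (if k = 0 then 1 else 0)"
    using k prod_th_nonzero[of d] prod_zero[of "{1..d}" "\<lambda>j. th k - th j"] by auto
  finally have s: "(\<Sum>h\<le>d. (\<Prod>j<h. th k - th j) / (\<Prod>j=1..h. th 0 - th j)) = (if k = 0 then 1 else 0)" .
  have "E k (\<Sum>h\<le>d. (1 / (\<Prod>j=1..h. th 0 - th j)) *s raise_prod A th h u) =
      (\<Sum>h\<le>d. (\<Prod>j<h. th k - th j) / (\<Prod>j=1..h. th 0 - th j)) *s E k u"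
    using k by (simp add: E_simps E_raise_prod scale_sum_left)
  thus "E k (E 0 u) = E k (\<Sum>h\<le>d. (1 / (\<Prod>j=1..h. th 0 - th j)) *s raise_prod A th h u)"
    unfolding s using k by (simp add: E_E)
qed

lemma E_0_raise_prod_As:
  assumes line: "line (range (E 0))" and v: "v \<in> range (E 0)" and i: "i \<le> d"
  shows "E 0 (raise_prod As star.th i v) =
    (split_seq d A E As Es i / (\<Prod>j=1..i. th 0 - th j)) *s v"
proof -
  define q where "q h = (\<Prod>j=1..h. th 0 - th j)" for h
  define z where "z = split_seq d A E As Es i"
  have line': "line (range (Es 0))" by (rule line_range_Es[OF line])
  obtain u where u: "u \<noteq> 0" "u \<in> range (Es 0)" using line' by (rule lineE) blast
  have ub: "u \<in> star.below (Suc 0)" using u(2) star.below_Suc_0 by blast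
  \<comment> \<open>For \<open>h < i\<close> the product in \<open>As\<close> annihilates the
    vector; for \<open>i < h\<close> the result still has zero component of index 0.\<close>
  have tm: "E 0 (raise_prod As star.th i (raise_prod A th h u)) = (if h = i then z *s E 0 u else 0)"
    for h
  proof -
    consider "h < i" | "h = i" | "i < h" by linarith
    thus ?thesis
    proof cases
      case 1
      hence "raise_prod A th h u \<in> star.below i"
        using star.below_mono[OF raise_prod_below[OF ub, of th h], of i] by simp
      thus ?thesis using 1 by (simp add: raise_prod_As_eq_0 E_0)
    next
      case 2
      \<comment> \<open>The roots \<open>star.th 0\<close> to \<open>star.th (i - 1)\<close> are
        exchanged for \<open>star.th 1\<close> to \<open>star.th i\<close>. \<open>E 0\<close>
        cannot detect this, as the vector lies in \<open>above i\<close>.\<close>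
      have "E 0 (raise_prod As star.th i (raise_prod A th i u)) =
          E 0 (lower_prod As star.th i (raise_prod A th i u))"
        unfolding star.lower_prod_eq_raise_prod
        by (rule E_raise_prod_As_bottom[OF raise_prod_above]) auto
      thus ?thesis
        using 2 by (simp add: lower_raise_split_seq[OF line' u(2)] z_def E_simps)
    next
      case 3
      have "raise_prod A th h u \<in> above (Suc 0 + i)"
        using above_mono[OF raise_prod_above, of "Suc 0 + i" h] 3 by simp
      hence "raise_prod As star.th i (raise_prod A th h u) \<in> above (Suc 0)"
        by (rule raise_prod_As_above)
      thus ?thesis using 3 aboveD[of _ "Suc 0" 0] by simp
    qed
  qed
  have "E 0 (raise_prod As star.th i (E 0 u)) =
      (\<Sum>h\<le>d. (1 / q h) *s E 0 (raise_prod As star.th i (raise_prod A th h u)))"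
    by (subst E_0_eq_sum_raise_prod)
      (simp add: star.raise_prod_sum star.raise_prod_scale E_simps q_def)
  also have "\<dots> = (\<Sum>h\<le>d. if h = i then (z / q i) *s E 0 u else 0)"
    unfolding tm by (rule sum.cong) auto
  also have "\<dots> = (z / q i) *s E 0 u" using i by simp
  finally have e: "E 0 (raise_prod As star.th i (E 0 u)) = (z / q i) *s E 0 u" .
  \<comment> \<open>The formula is now known for \<open>E 0 u\<close>, which is nonzero by
    \<open>E_0_inj\<close> and hence spans the line containing \<open>v\<close>.\<close>
  obtain e0 where e0: "\<And>v. v \<in> range (E 0) \<Longrightarrow> \<exists>c. v = c *s e0"
    using line by (rule lineE) blast
  obtain a where a: "E 0 u = a *s e0" using e0[of "E 0 u"] by blast
  obtain b where b: "v = b *s e0" using e0[OF v] by blast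
  have "a \<noteq> 0" using E_0_inj[OF u(2)] u(1) a by auto
  hence v': "v = (b / a) *s E 0 u" by (simp add: a b)
  show ?thesis
    unfolding q_def[symmetric] z_def[symmetric]
    by (subst (1 2) v') (simp add: star.raise_prod_scale E_simps e mult.commute)
qed

text \<open>Otherwise the product would lie in \<open>star.below t \<inter> above t\<close> and
  vanish. Its component of index \<open>d\<close> is a nonzero multiple of \<open>E d u\<close>, so
  \<open>E d u = 0\<close>, and \<open>E_0_inj\<close> for the reversed system gives
  \<open>u = 0\<close>.\<close>

lemma Es_raise_prod_nonzero:
  assumes u: "u \<in> range (Es 0)" "u \<noteq> 0" and t: "t \<le> d"
  shows "Es t (raise_prod A th t u) \<noteq> 0"
proof
  assume z: "Es t (raise_prod A th t u) = 0"
  have "raise_prod A th t u \<in> star.below (Suc t)"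
    using raise_prod_below[of u "Suc 0" th t] u star.below_Suc_0 by simp
  hence "raise_prod A th t u \<in> star.below t"
    using z by (auto simp: star.below_def le_eq_less_or_eq)
  hence "raise_prod A th t u = 0" by (rule below_above[OF _ raise_prod_above])
  hence "(\<Prod>j<t. th d - th j) *s E d u = 0"
    using E_raise_prod[of d th t u] by (simp add: E_simps)
  moreover have "(\<Prod>j<t. th d - th j) \<noteq> 0"
    using t by (auto simp: ev_eq_iff)
  ultimately have "E d u = 0" by simp
  moreover interpret rev: td_system scale Basis d A "\<lambda>i. E (d - i)" As Es
    by (rule td_system_reverse) unfold_locales
  have "E d u = 0 \<Longrightarrow> u = 0" using rev.E_0_inj[OF u(1)] by simp
  ultimately show False using u(2) by blast
qed

section \<open>A common recurrence for both eigenvalue sequences\<close>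

lemma eigenvalues_recurrent: "\<exists>c. recurrent d c th \<and> recurrent d c star.th"
proof (cases "3 \<le> d")
  case False
  thus ?thesis by (simp add: recurrent_def)
next
  case True
  \<comment> \<open>Consecutive values are made to differ by the coefficient with which
    \<open>A A As A - A As A A\<close> acts on the block of \<open>As\<close> between adjacent
    eigenspaces. \<open>Z\<close> will act on the range of \<open>E k\<close> as the scalar
    \<open>z k\<close>.\<close>
  define z where "z k = - (\<Sum>j<k. th j * th (Suc j) * (th j - th (Suc j)))" for k
  have zS: "z k - z (Suc k) = th k * th (Suc k) * (th k - th (Suc k))" for k
    by (simp add: z_def)
  obtain \<alpha> where \<alpha>: "\<And>k. k \<le> d \<Longrightarrow> z k = (\<Sum>t\<le>d. \<alpha> t * (\<Prod>j<t. th k - th j))"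
    using newton_interpolation[OF inj_ev] by blast
  define Z where "Z v = (\<Sum>t\<le>d. \<alpha> t *s raise_prod A th t v)" for v
  have EZ: "E k (Z v) = z k *s E k v" if "k \<le> d" for k v
    using that by (simp add: Z_def \<alpha> E_simps E_raise_prod scale_sum_left)
  have Z_add: "Z (v + w) = Z v + Z w" and Z_scale: "Z (c *s v) = c *s Z v" for v w c
    by (simp_all add: Z_def raise_prod_add raise_prod_scale scale_right_distrib sum.distrib
        scale_sum_right mult.commute)
  have comm: "A (A (As (A v))) - A (As (A (A v))) = Z (As v) - As (Z v)" for v
  proof (rule eqI)
    fix i assume i: "i \<le> d"
    define K where "K l = E i (As (E l v))" for l
    have EAs: "E i (As w) = (\<Sum>l\<le>d. E i (As (E l w)))" for w by (rule E_As[OF i])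
    have lin: "E i (As (c *s w)) = c *s E i (As w)" for c w
      using i by (simp add: star.A.scale E_simps)
    have K: "(th i * th i * th l - th i * (th l * th l)) *s K l = (z i - z l) *s K l" if "l \<le> d" for l
    proof -
      consider "i + 1 < l \<or> l + 1 < i" | "l = i" | "l = Suc i" | "i = Suc l" by linarith
      thus ?thesis
      proof cases
        case 1
        thus ?thesis using E_As_E i that by (simp add: K_def)
      next
        case 3
        have "z i - z l = th i * th i * th l - th i * (th l * th l)"
          using zS[of i] 3 by (simp add: algebra_simps)
        thus ?thesis by simp
      next
        case 4
        have "z i - z l = th i * th i * th l - th i * (th l * th l)"
          using zS[of l] 4 by (simp add: algebra_simps)
        thus ?thesis by simp
      qed simp
    qed
    have "E i (A (A (As (A v))) - A (As (A (A v)))) =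
        (\<Sum>l\<le>d. (th i * th i * th l - th i * (th l * th l)) *s K l)"
      using i unfolding K_def
      by (simp add: E_simps E_A EAs[of "A v"] EAs[of "A (A v)"] lin scale_sum_right
          scale_left_diff_distrib sum_subtractf mult_ac)
    also have "\<dots> = (\<Sum>l\<le>d. (z i - z l) *s K l)" by (rule sum.cong) (use K in auto)
    also have "\<dots> = E i (Z (As v) - As (Z v))"
      using i unfolding K_def
      by (simp add: E_simps EZ EAs[of v] EAs[of "Z v"] lin scale_sum_right
          scale_left_diff_distrib sum_subtractf)
    finally show "E i (A (A (As (A v))) - A (As (A (A v)))) = E i (Z (As v) - As (Z v))" .
  qed
  obtain w where w: "Es 0 w \<noteq> 0" using star.E_nonzero[of 0] by blast
  define u where "u = Es 0 w"
  have u: "u \<in> range (Es 0)" "u \<noteq> 0" using w by (auto simp: u_def)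
  have ub: "u \<in> star.below (Suc 0)" using u(1) star.below_Suc_0 by blast
  note nz = Es_raise_prod_nonzero[OF u]
  \<comment> \<open>Take the largest bad index \<open>m\<close> and compare components of index
    \<open>m\<close> in \<open>comm\<close> at \<open>u\<close>. Three applications of
    \<open>A\<close> reach index 3 at most, while the other side gives
    \<open>(star.th 0 - star.th m) * \<alpha> m\<close> times a nonzero vector.\<close>
  have \<alpha>0: "\<alpha> t = 0" if t: "3 < t" "t \<le> d" for t
  proof (rule ccontr)
    assume "\<alpha> t \<noteq> 0"
    define T where "T = {t. 3 < t \<and> t \<le> d \<and> \<alpha> t \<noteq> 0}"
    define m where "m = Max T"
    have fin: "finite T" by (rule finite_subset[of _ "{..d}"]) (auto simp: T_def)
    have "T \<noteq> {}" using t \<open>\<alpha> t \<noteq> 0\<close> by (auto simp: T_def)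
    hence "m \<in> T" unfolding m_def by (rule Max_in[OF fin])
    hence m: "3 < m" "m \<le> d" "\<alpha> m \<noteq> 0" by (auto simp: T_def)
    have above_m: "\<alpha> s = 0" if "m < s" "s \<le> d" for s
    proof (rule ccontr)
      assume "\<alpha> s \<noteq> 0"
      hence "s \<in> T" using that m by (auto simp: T_def)
      hence "s \<le> m" unfolding m_def by (rule Max_ge[OF fin])
      thus False using that by simp
    qed
    have "Es m (Z u) = (\<Sum>s\<le>d. if s = m then \<alpha> m *s Es m (raise_prod A th m u) else 0)"
    proof -
      have "\<alpha> s *s Es m (raise_prod A th s u) = 0" if "s \<le> d" "s \<noteq> m" for s
        using that above_m[of s] star.belowD[OF raise_prod_below[OF ub, of th s], of m] m(2)
        by (cases "m < s") auto
      hence "(\<Sum>s\<le>d. \<alpha> s *s Es m (raise_prod A th s u)) =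
          (\<Sum>s\<le>d. if s = m then \<alpha> m *s Es m (raise_prod A th m u) else 0)"
        by (intro sum.cong) auto
      thus ?thesis unfolding Z_def using m(2) by (simp only: star.E_simps)
    qed
    hence EZm: "Es m (Z u) = \<alpha> m *s Es m (raise_prod A th m u)" using m(2) by simp
    have Asu: "As u = star.th 0 *s u" unfolding u_def by (simp add: star.A_E)
    have "A (A (As (A u))) \<in> star.below (Suc (Suc (Suc (Suc 0))))"
      by (intro A_below star.below_A ub)
    moreover have "A (As (A (A u))) \<in> star.below (Suc (Suc (Suc (Suc 0))))"
      by (intro A_below star.below_A ub)
    ultimately have "Es m (A (A (As (A u))) - A (As (A (A u)))) = 0"
      using m by (simp add: star.E_simps star.belowD)
    hence "Es m (Z (As u) - As (Z u)) = 0" by (simp add: comm)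
    hence "((star.th 0 - star.th m) * \<alpha> m) *s Es m (raise_prod A th m u) = 0"
      using m by (simp add: Asu Z_scale star.E_simps star.E_A EZm scale_left_diff_distrib left_diff_distrib)
    moreover have "star.th 0 \<noteq> star.th m"
      using inj_onD[OF star.inj_ev, of 0 m] m by auto
    ultimately show False using nz[OF m(2)] m(3) by simp
  qed
  define a where "a = \<alpha> 3"
  \<comment> \<open>Now \<open>comm\<close> is applied to \<open>raise_prod A th i u\<close> and
    read at index \<open>i + 3\<close>, the highest that either side reaches. Each term there is a
    multiple of one nonzero vector \<open>R\<close>.\<close>
  have star: "star.th (i + 1) - star.th (i + 2) = a * (star.th i - star.th (i + 3))"
    if i: "i + 3 \<le> d" for i
  proof -
    define y where "y = raise_prod A th i u"
    define k where "k = i + 3"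
    define R where "R = Es k (A (A (A y)))"
    have k: "k \<le> d" using i by (simp add: k_def)
    have yb: "y \<in> star.below (Suc i)" using raise_prod_below[OF ub, of th i] by (simp add: y_def)
    have low: "Es k v = 0" if "v \<in> star.below k" for v using star.belowD[OF that] k by simp
    have cube: "raise_prod A (\<lambda>_. 0) 3 y = A (A (A y))" by (simp add: numeral_3_eq_3)
    have R: "R = Es k (raise_prod A x 3 y)" for x
      unfolding R_def cube[symmetric] by (rule Es_raise_prod_top[OF yb k]) (simp add: k_def)
    have R0: "R \<noteq> 0"
    proof -
      \<comment> \<open>The roots \<open>th i\<close> to \<open>th (i + 2)\<close> continue
        \<open>y\<close> to \<open>raise_prod A th (i + 3) u\<close>, whose top component is
        nonzero.\<close>
      have "raise_prod A (\<lambda>j. th (i + j)) 3 y = raise_prod A th (i + 3) u"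
        by (simp add: y_def numeral_3_eq_3)
      hence "R = Es k (raise_prod A th k u)" using R[of "\<lambda>j. th (i + j)"] by (simp add: k_def)
      thus ?thesis using nz[OF k] by simp
    qed
    \<comment> \<open>By \<open>\<alpha>0\<close> the map \<open>Z\<close> is at most cubic in
      \<open>A\<close>, so it reaches at most three indices higher.\<close>
    have EZ_low: "Es k (Z v) = 0" if v: "v \<in> star.below i" for v
    proof -
      have "\<alpha> t *s Es k (raise_prod A th t v) = 0" if "t \<le> d" for t
        using \<alpha>0[of t] that low[OF star.below_mono[OF raise_prod_below[OF v, of th t]]]
        by (cases "3 < t") (auto simp: k_def)
      hence "(\<Sum>t\<le>d. \<alpha> t *s Es k (raise_prod A th t v)) = 0" by (intro sum.neutral) auto
      thus ?thesis unfolding Z_def by (simp only: star.E_simps k)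
    qed
    have EZy: "Es k (Z y) = a *s R"
    proof -
      have "\<alpha> t *s Es k (raise_prod A th t y) = (if t = 3 then a *s R else 0)" if "t \<le> d" for t
      proof -
        consider "t < 3" | "t = 3" | "3 < t" by linarith
        thus ?thesis
        proof cases
          case 1
          thus ?thesis using low[OF star.below_mono[OF raise_prod_below[OF yb, of th t]]]
            by (simp add: k_def)
        next
          case 2
          thus ?thesis using R[of th] by (simp add: a_def)
        next
          case 3
          thus ?thesis using \<alpha>0 that by simp
        qed
      qed
      hence "(\<Sum>t\<le>d. \<alpha> t *s Es k (raise_prod A th t y)) =
          (\<Sum>t\<le>d. if t = 3 then a *s R else 0)"
        by (intro sum.cong) auto
      hence "Es k (Z y) = (\<Sum>t\<le>d. if t = 3 then a *s R else 0)"
        unfolding Z_def by (simp only: star.E_simps k)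
      thus ?thesis using True by simp
    qed
    have 1: "Es k (A (A (As (A y)))) = star.th (i + 1) *s R"
    proof -
      \<comment> \<open>On the top component \<open>As\<close> acts by its eigenvalue; the remainder
        \<open>v\<close> is too low to reach index \<open>k\<close>. The next two computations use
        the same device.\<close>
      define v where "v = As (A y) - star.th (i + 1) *s A y"
      have "v \<in> star.below (i + 1)"
        unfolding v_def using star.below_lower[of "A y" "i + 1"] A_below[OF yb] by simp
      hence "A (A v) \<in> star.below k" using A_below[of v "i + 1"] A_below[of "A v" "i + 2"]
        by (simp add: k_def numeral_3_eq_3)
      moreover have "As (A y) = star.th (i + 1) *s A y + v" by (simp add: v_def)
      ultimately show ?thesis using k low by (simp add: A.add A.scale star.E_simps R_def)
    qed
    have 2: "Es k (A (As (A (A y)))) = star.th (i + 2) *s R"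
    proof -
      define v where "v = As (A (A y)) - star.th (i + 2) *s A (A y)"
      have "v \<in> star.below (i + 2)"
        unfolding v_def using star.below_lower[of "A (A y)" "i + 2"] A_below[OF A_below[OF yb]] by simp
      hence "A v \<in> star.below k" using A_below[of v "i + 2"] by (simp add: k_def numeral_3_eq_3)
      moreover have "As (A (A y)) = star.th (i + 2) *s A (A y) + v" by (simp add: v_def)
      ultimately show ?thesis using k low by (simp add: A.add A.scale star.E_simps R_def)
    qed
    have 3: "Es k (Z (As y)) = star.th i *s (a *s R)"
    proof -
      define v where "v = As y - star.th i *s y"
      have "Es k (Z v) = 0" unfolding v_def by (rule EZ_low[OF star.below_lower[OF yb]])
      moreover have "As y = star.th i *s y + v" by (simp add: v_def)
      ultimately show ?thesis using k by (simp add: Z_add Z_scale star.E_simps EZy)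
    qed
    have 4: "Es k (As (Z y)) = star.th k *s (a *s R)" using k by (simp add: star.E_A EZy)
    have "Es k (A (A (As (A y))) - A (As (A (A y)))) = Es k (Z (As y) - As (Z y))"
      by (simp only: comm)
    hence "(star.th (i + 1) - star.th (i + 2)) *s R = (a * (star.th i - star.th k)) *s R"
      using k 1 2 3 4 by (simp add: star.E_simps algebra_simps)
    thus ?thesis using R0 by (simp add: k_def)
  qed
  \<comment> \<open>The interpolating polynomial in Newton form, of degree at most 3 by
    \<open>\<alpha>0\<close>. Its leading coefficient is the \<open>a\<close> that governs the dual
    eigenvalues, which gives both sequences the same constant.\<close>
  define g where "g x = \<alpha> 0 + \<alpha> 1 * (x - th 0) + \<alpha> 2 * ((x - th 0) * (x - th 1)) +
    a * ((x - th 0) * (x - th 1) * (x - th 2))" for x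
  have zg: "z k = g (th k)" if "k \<le> d" for k
  proof -
    have "z k = (\<Sum>t\<le>3. \<alpha> t * (\<Prod>j<t. th k - th j))"
      unfolding \<alpha>[OF that] by (rule sum.mono_neutral_right) (use True \<alpha>0 in auto)
    also have "\<dots> = g (th k)" by (simp add: g_def a_def numeral_eq_Suc atMost_Suc lessThan_Suc)
    finally show ?thesis .
  qed
  obtain b0 b1 b2 where g: "\<And>x. g x = a * x ^ 3 + b2 * x ^ 2 + b1 * x + b0"
  proof
    show "g x = a * x ^ 3 + (\<alpha> 2 - a * (th 0 + th 1 + th 2)) * x ^ 2 +
      (\<alpha> 1 - \<alpha> 2 * (th 0 + th 1) + a * (th 0 * th 1 + th 0 * th 2 + th 1 * th 2)) * x +
      (\<alpha> 0 - \<alpha> 1 * th 0 + \<alpha> 2 * th 0 * th 1 - a * th 0 * th 1 * th 2)" for x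
      by (simp add: g_def algebra_simps power2_eq_square power3_eq_cube)
  qed
  have th: "th (i + 1) - th (i + 2) = a * (th i - th (i + 3))" if i: "i + 3 \<le> d" for i
  proof (rule cubic_divided_differences[symmetric])
    have gz: "g (th j) - g (th (Suc j)) = th j * th (Suc j) * (th j - th (Suc j))" if "j < d" for j
      using zS[of j] zg that by simp
    show "(a * th i ^ 3 + b2 * th i ^ 2 + b1 * th i + b0) -
        (a * th (i + 1) ^ 3 + b2 * th (i + 1) ^ 2 + b1 * th (i + 1) + b0) =
        th i * th (i + 1) * (th i - th (i + 1))"
      using gz[of i] i unfolding g by simp
    show "(a * th (i + 1) ^ 3 + b2 * th (i + 1) ^ 2 + b1 * th (i + 1) + b0) -
        (a * th (i + 2) ^ 3 + b2 * th (i + 2) ^ 2 + b1 * th (i + 2) + b0) =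
        th (i + 1) * th (i + 2) * (th (i + 1) - th (i + 2))"
      using gz[of "i + 1"] i unfolding g by simp
    show "(a * th (i + 2) ^ 3 + b2 * th (i + 2) ^ 2 + b1 * th (i + 2) + b0) -
        (a * th (i + 3) ^ 3 + b2 * th (i + 3) ^ 2 + b1 * th (i + 3) + b0) =
        th (i + 2) * th (i + 3) * (th (i + 2) - th (i + 3))"
      using gz[of "i + 2"] i unfolding g by (simp add: numeral_3_eq_3)
  qed (use i in \<open>auto simp: ev_eq_iff\<close>)
  \<comment> \<open>Distinct dual eigenvalues make the left side of \<open>star\<close> nonzero, so
    \<open>a\<close> is invertible and the constant is \<open>1 / a\<close>.\<close>
  have "star.th 1 - star.th 2 \<noteq> 0"
    using True inj_onD[OF star.inj_ev, of 1 2] by auto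
  hence "a \<noteq> 0" using star[of 0] True by (auto simp: numeral_2_eq_2)
  hence "recurrent d (1 / a) th \<and> recurrent d (1 / a) star.th"
    using star th by (simp add: recurrent_def)
  thus ?thesis by blast
qed

end

section \<open>The transition formulas\<close>

lemma (in pos_fin_dim_vector_space) spectral_if_primitive_idempotents:
  assumes lin: "Vector_Spaces.linear scale scale A" and diag: "diagonalizable A"
    and prim: "\<And>i. i \<le> d \<Longrightarrow> primitive_idempotent A (E i)"
    and bij: "bij_betw (\<lambda>i. range (E i)) {..d} (eigenspaces A)"
  shows "spectral scale Basis d A E"
proof -
  have linE: "Vector_Spaces.linear scale scale (E i)" if "i \<le> d" for i
    using prim[OF that] by (simp add: primitive_idempotent_def)
  have "\<forall>i\<in>{..d}. \<exists>c. eigenvalue A c \<and> (\<forall>v\<in>eigenspace A c. E i v = v) \<and>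
      (\<forall>c'. c' \<noteq> c \<longrightarrow> (\<forall>v\<in>eigenspace A c'. E i v = 0))"
    using prim by (auto simp: primitive_idempotent_def)
  then obtain c where "\<forall>i\<in>{..d}. eigenvalue A (c i) \<and> (\<forall>v\<in>eigenspace A (c i). E i v = v) \<and>
      (\<forall>c'. c' \<noteq> c i \<longrightarrow> (\<forall>v\<in>eigenspace A c'. E i v = 0))"
    by (rule bchoice[THEN exE])
  hence c: "eigenvalue A (c i)" "v \<in> eigenspace A (c i) \<Longrightarrow> E i v = v"
      "c' \<noteq> c i \<Longrightarrow> v \<in> eigenspace A c' \<Longrightarrow> E i v = 0" if "i \<le> d" for i v c'
    using that by auto
  \<comment> \<open>The bijection makes the range some eigenspace; an eigenvector for
    \<open>c i\<close>, fixed by \<open>E i\<close>, shows which one.\<close>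
  have range: "range (E i) = eigenspace A (c i)" if i: "i \<le> d" for i
  proof -
    have "range (E i) \<in> eigenspaces A" using bij i by (auto simp: bij_betw_def)
    then obtain c' where c': "range (E i) = eigenspace A c'" by (auto simp: eigenspaces_def)
    obtain v where v: "v \<noteq> 0" "A v = scale (c i) v" using c(1)[OF i] by (auto simp: eigenvalue_def)
    have "E i v = v" using c(2)[OF i] v by (simp add: eigenspace_def)
    hence "v \<in> eigenspace A c'" using c' by (metis rangeI)
    hence "c' = c i" using v by (simp add: eigenspace_def)
    thus ?thesis using c' by simp
  qed
  have nz: "\<exists>v. E i v \<noteq> 0" if i: "i \<le> d" for i
  proof -
    obtain v where "v \<noteq> 0" "A v = scale (c i) v" using c(1)[OF i] by (auto simp: eigenvalue_def)
    hence "E i v \<noteq> 0" using c(2)[OF i, of v] by (simp add: eigenspace_def)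
    thus ?thesis by blast
  qed
  have AE: "A (E i v) = scale (c i) (E i v)" if "i \<le> d" for i v
    using range[OF that] by (auto simp: eigenspace_def)
  have ev: "eigenvalue_seq A E i = c i" if i: "i \<le> d" for i
  proof -
    obtain v where "E i v \<noteq> 0" using nz[OF i] by blast
    thus ?thesis
      unfolding eigenvalue_seq_def
      by (intro eigenvalue_on_eq[of "E i v"]) (use AE[OF i] in auto)
  qed
  have inj: "inj_on c {..d}"
  proof (rule inj_onI)
    fix i j assume ij: "i \<in> {..d}" "j \<in> {..d}" "c i = c j"
    hence "range (E i) = range (E j)" using range by simp
    thus "i = j" using bij ij(1,2) by (auto simp: bij_betw_def dest: inj_onD)
  qed
  have EE: "E i (E j v) = (if i = j then E j v else 0)" if "i \<le> d" "j \<le> d" for i j v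
  proof (cases "i = j")
    case True
    thus ?thesis using c(2)[OF that(1)] range[OF that(1)] by auto
  next
    case False
    hence "c j \<noteq> c i" using inj that by (auto dest: inj_onD)
    moreover have "E j v \<in> eigenspace A (c j)" using range[OF that(2)] by auto
    ultimately show ?thesis using c(3)[OF that(1)] False by auto
  qed
  have E_lin: "E i (v + w) = E i v + E i w" "E i (scale r v) = scale r (E i v)" "E i 0 = 0"
    if "i \<le> d" for i v w r
  proof -
    interpret Ei: Vector_Spaces.linear scale scale "E i" by (rule linE[OF that])
    show "E i (v + w) = E i v + E i w" "E i (scale r v) = scale r (E i v)" "E i 0 = 0"
      by (rule Ei.add Ei.scale Ei.zero)+
  qed
  \<comment> \<open>The sum of all \<open>E i\<close> is the identity on each eigenspace, and the
    eigenspaces span.\<close>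
  have "span (\<Union> (eigenspaces A)) \<subseteq> {v. (\<Sum>i\<le>d. E i v) = v}"
  proof (rule span_minimal)
    show "\<Union> (eigenspaces A) \<subseteq> {v. (\<Sum>i\<le>d. E i v) = v}"
    proof
      fix v assume "v \<in> \<Union> (eigenspaces A)"
      moreover have "eigenspaces A = (\<lambda>i. range (E i)) ` {..d}" using bij by (simp add: bij_betw_def)
      ultimately obtain j w where j: "j \<le> d" "v = E j w" by auto
      have "(\<Sum>i\<le>d. E i v) = (\<Sum>i\<le>d. if i = j then v else 0)"
        by (rule sum.cong) (use j EE in auto)
      thus "v \<in> {v. (\<Sum>i\<le>d. E i v) = v}" using j by simp
    qed
    show "subspace {v. (\<Sum>i\<le>d. E i v) = v}"
      by (rule subspaceI) (simp_all add: E_lin sum.distrib flip: scale_sum_right)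
  qed
  hence sum: "(\<Sum>i\<le>d. E i v) = v" for v using diag by (auto simp: diagonalizable_def)
  show ?thesis
  proof (intro spectral.intro spectral_axioms.intro pos_fin_dim_vector_space_axioms)
    show "inj_on (eigenvalue_seq A E) {..d}" using inj ev by (simp add: inj_on_def)
    show "A (E i v) = scale (eigenvalue_seq A E i) (E i v)" if "i \<le> d" for i v
      using AE ev that by simp
  qed (fact lin linE EE sum nz)+
qed

lemma (in spectral) E_B_E_eq_0:
  assumes "standard_ordering d A B (\<lambda>i. range (E i))"
    and "i \<le> d" "j \<le> d" "i + 1 < j \<or> j + 1 < i"
  shows "E i (B (E j v)) = 0"
proof -
  have "B (E j v) \<in> span (\<Union>k\<in>{k. k \<le> d \<and> j \<le> k + 1 \<and> k \<le> j + 1}. range (E k))"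
    using assms(1,3) unfolding standard_ordering_def by blast
  moreover have "span (\<Union>k\<in>{k. k \<le> d \<and> j \<le> k + 1 \<and> k \<le> j + 1}. range (E k)) \<subseteq> {w. E i w = 0}"
  proof (rule span_minimal)
    show "subspace {w. E i w = 0}" by (rule subspaceI) (simp_all add: E_simps assms(2))
  qed (use assms(2,4) in \<open>auto simp: E_E\<close>)
  ultimately show ?thesis by blast
qed

lemma (in pos_fin_dim_vector_space) td_system_if_tridiagonal_system:
  assumes "tridiagonal_system d A E As Es"
  shows "td_system scale Basis d A E As Es"
proof -
  have pair: "tridiagonal_pair A As"
    and prim: "\<forall>i\<le>d. primitive_idempotent A (E i)" "\<forall>i\<le>d. primitive_idempotent As (Es i)"
    and ord: "standard_ordering d A As (\<lambda>i. range (E i))"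
      "standard_ordering d As A (\<lambda>i. range (Es i))"
    using assms unfolding tridiagonal_system_def by simp_all
  have lin: "Vector_Spaces.linear scale scale A" "Vector_Spaces.linear scale scale As"
    and diag: "diagonalizable A" "diagonalizable As"
    and irred: "\<not> (\<exists>W. subspace W \<and> W \<noteq> {0} \<and> W \<noteq> UNIV \<and> A ` W \<subseteq> W \<and> As ` W \<subseteq> W)"
    using pair unfolding tridiagonal_pair_def by - (elim conjE; assumption)+
  have bij: "bij_betw (\<lambda>i. range (E i)) {..d} (eigenspaces A)"
      "bij_betw (\<lambda>i. range (Es i)) {..d} (eigenspaces As)"
    using ord unfolding standard_ordering_def by - (elim conjE; assumption)+
  have s: "spectral scale Basis d A E"
    by (rule spectral_if_primitive_idempotents[OF lin(1) diag(1) prim(1)[rule_format] bij(1)])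
  have ss: "spectral scale Basis d As Es"
    by (rule spectral_if_primitive_idempotents[OF lin(2) diag(2) prim(2)[rule_format] bij(2)])
  show ?thesis
  proof (intro td_system.intro td_system_axioms.intro s ss)
    show "W = {0} \<or> W = UNIV" if "subspace W" "A ` W \<subseteq> W" "As ` W \<subseteq> W" for W
      using irred that by blast
  qed (fact spectral.E_B_E_eq_0[OF s ord(1)] spectral.E_B_E_eq_0[OF ss ord(2)])+
qed

section \<open>Effect of reversing one ordering\<close>

context td_system
begin

lemma lin_E_0: "Vector_Spaces.linear scale scale (E 0)"
  by (rule lin_E) simp

text \<open>Reversing \<open>E\<close> keeps \<open>Es 0\<close> and a vector \<open>e\<close> of
  its range, but replaces \<open>tau_poly\<close> by \<open>eta_poly\<close> evaluated at
  \<open>A\<close>. Applying \<open>Es 0\<close> to the two polynomial expansions at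
  \<open>e\<close> gives the two formulas.\<close>

lemma split_seq_Down_transition:
  assumes line: "line (range (Es 0))"
    and br: "bracket_recurrence d th br" "bracket_recurrence d (\<lambda>i. th (d - i)) br"
    and i: "i \<le> d"
  defines "zD \<equiv> split_seq d A (\<lambda>i. E (d - i)) As Es" and "z \<equiv> split_seq d A E As Es"
  shows "zD i / (\<Prod>j=1..i. star.th 0 - star.th j) =
      (\<Sum>h=0..i. br h (i - h) (d - i) * poly (eta_poly d th (i - h)) (th 0) * z h
        / (\<Prod>j=1..h. star.th 0 - star.th j)) \<and>
    z i / (\<Prod>j=1..i. star.th 0 - star.th j) =
      (\<Sum>h=0..i. br h (i - h) (d - i) * poly (tau_poly th (i - h)) (th d) * zD h
        / (\<Prod>j=1..h. star.th 0 - star.th j))"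
proof -
  interpret rev: td_system scale Basis d A "\<lambda>i. E (d - i)" As Es
    by (rule td_system_reverse) unfold_locales
  have rth: "rev.th = (\<lambda>i. th (d - i))" by (rule eigenvalue_seq_comp) unfold_locales
  obtain e where e: "e \<noteq> 0" "e \<in> range (Es 0)" using line by (rule lineE) blast
  note F = star.lin_E[of 0, simplified]
  have 1: "Es 0 (raise_prod A th h e) = (z h / (\<Prod>j=1..h. star.th 0 - star.th j)) *s e" if "h \<le> d" for h
    unfolding z_def by (rule Es_0_raise_prod[OF line e(2) that])
  have 2: "Es 0 (raise_prod A (\<lambda>i. th (d - i)) h e) =
      (zD h / (\<Prod>j=1..h. star.th 0 - star.th j)) *s e" if "h \<le> d" for h
    using rev.Es_0_raise_prod[OF line e(2) that] unfolding zD_def rth .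
  have "zD i / (\<Prod>j=1..i. star.th 0 - star.th j) =
      (\<Sum>h=0..i. br h (i - h) (d - i) * poly (eta_poly d th (i - h)) (th 0) *
        (z h / (\<Prod>j=1..h. star.th 0 - star.th j)))"
    by (rule raise_prod_scalars_expansion[OF F e(1) 2[OF i] 1])
      (use i eta_poly_expansion[OF br(1) i] in \<open>simp_all add: eta_poly_def tau_poly_def\<close>)
  moreover have "z i / (\<Prod>j=1..i. star.th 0 - star.th j) =
      (\<Sum>h=0..i. br h (i - h) (d - i) * poly (tau_poly th (i - h)) (th d) *
        (zD h / (\<Prod>j=1..h. star.th 0 - star.th j)))"
    by (rule raise_prod_scalars_expansion[OF F e(1) 1[OF i] 2])
      (use i tau_poly_expansion[OF br(2) i] in \<open>simp_all add: eta_poly_def tau_poly_def\<close>)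
  ultimately show ?thesis by simp
qed

text \<open>Here \<open>E 0\<close> and a vector of its range stay fixed while the ordering of
  \<open>Es\<close> is reversed. \<open>E_0_raise_prod_As\<close> expresses the same split sequences
  through products in \<open>As\<close>.\<close>

lemma split_seq_down_transition:
  assumes line: "line (range (E 0))"
    and br: "bracket_recurrence d star.th br" "bracket_recurrence d (\<lambda>i. star.th (d - i)) br"
    and i: "i \<le> d"
  defines "zd \<equiv> split_seq d A E As (\<lambda>i. Es (d - i))" and "z \<equiv> split_seq d A E As Es"
  shows "zd i / (\<Prod>j=1..i. th 0 - th j) =
      (\<Sum>h=0..i. br h (i - h) (d - i) * poly (eta_poly d star.th (i - h)) (star.th 0) * z h
        / (\<Prod>j=1..h. th 0 - th j)) \<and>
    z i / (\<Prod>j=1..i. th 0 - th j) =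
      (\<Sum>h=0..i. br h (i - h) (d - i) * poly (tau_poly star.th (i - h)) (star.th d) * zd h
        / (\<Prod>j=1..h. th 0 - th j))"
proof -
  interpret rev: td_system scale Basis d A E As "\<lambda>i. Es (d - i)"
    by (rule td_system_dual, rule td_system_reverse, rule td_system_dual) unfold_locales
  have rth: "rev.star.th = (\<lambda>i. star.th (d - i))" by (rule eigenvalue_seq_comp) unfold_locales
  obtain e where e: "e \<noteq> 0" "e \<in> range (E 0)" using line by (rule lineE) blast
  have 1: "E 0 (raise_prod As star.th h e) = (z h / (\<Prod>j=1..h. th 0 - th j)) *s e" if "h \<le> d" for h
    unfolding z_def by (rule E_0_raise_prod_As[OF line e(2) that])
  have 2: "E 0 (raise_prod As (\<lambda>i. star.th (d - i)) h e) =
      (zd h / (\<Prod>j=1..h. th 0 - th j)) *s e" if "h \<le> d" for h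
    using rev.E_0_raise_prod_As[OF line e(2) that] unfolding zd_def rth .
  have "zd i / (\<Prod>j=1..i. th 0 - th j) =
      (\<Sum>h=0..i. br h (i - h) (d - i) * poly (eta_poly d star.th (i - h)) (star.th 0) *
        (z h / (\<Prod>j=1..h. th 0 - th j)))"
    by (rule star.raise_prod_scalars_expansion[OF lin_E_0 e(1) 2[OF i] 1])
      (use i eta_poly_expansion[OF br(1) i] in \<open>simp_all add: eta_poly_def tau_poly_def\<close>)
  moreover have "z i / (\<Prod>j=1..i. th 0 - th j) =
      (\<Sum>h=0..i. br h (i - h) (d - i) * poly (tau_poly star.th (i - h)) (star.th d) *
        (zd h / (\<Prod>j=1..h. th 0 - th j)))"
    by (rule star.raise_prod_scalars_expansion[OF lin_E_0 e(1) 1[OF i] 2])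
      (use i tau_poly_expansion[OF br(2) i] in \<open>simp_all add: eta_poly_def tau_poly_def\<close>)
  ultimately show ?thesis by simp
qed

lemma qbracket_recurrences:
  assumes q: "q \<noteq> 0" and ratio: "d \<ge> 3 \<Longrightarrow> q + inverse q + 1 = to_ac (common_ratio d th star.th)"
  shows "bracket_recurrence d th (qbracket q)" "bracket_recurrence d (\<lambda>i. th (d - i)) (qbracket q)"
    "bracket_recurrence d star.th (qbracket q)"
    "bracket_recurrence d (\<lambda>i. star.th (d - i)) (qbracket q)"
proof -
  obtain c where c: "recurrent d c th" "recurrent d c star.th" using eigenvalues_recurrent by blast
  have c_q: "to_ac c = q + inverse q + 1" if "d \<ge> 3"
    unfolding ratio[OF that] common_ratio_eq[OF that inj_ev star.inj_ev c] ..
  have br: "bracket_recurrence d f (qbracket q)" if "inj_on f {..d}" "recurrent d c f" for f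
    by (rule qbracket_recurrence[OF that(1) q that(2)]) (rule c_q)
  show "bracket_recurrence d th (qbracket q)"
    by (rule br[OF inj_ev c(1)])
  show "bracket_recurrence d (\<lambda>i. th (d - i)) (qbracket q)"
    by (rule br[OF inj_on_reverse[OF inj_ev] recurrent_reverse[OF c(1)]])
  show "bracket_recurrence d star.th (qbracket q)"
    by (rule br[OF star.inj_ev c(2)])
  show "bracket_recurrence d (\<lambda>i. star.th (d - i)) (qbracket q)"
    by (rule br[OF inj_on_reverse[OF star.inj_ev] recurrent_reverse[OF c(2)]])
qed

end

theorem theorem9p3:
  fixes scale :: "'k::field \<Rightarrow> 'v::ab_group_add \<Rightarrow> 'v"
    and Basis :: "'v set"
    and d :: nat
    and A As :: "'v \<Rightarrow> 'v"
    and E Es :: "nat \<Rightarrow> 'v \<Rightarrow> 'v"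
    and \<theta> \<theta>s \<zeta> \<zeta>d \<zeta>D \<zeta>dD :: "nat \<Rightarrow> 'k"
    and q :: "'k alg_closure"
  assumes space: "pos_fin_dim_vector_space scale Basis"
    and sharp: "pos_fin_dim_vector_space.sharp_tridiagonal_system scale d A E As Es"
    and eigenvalues: "\<theta> = pos_fin_dim_vector_space.eigenvalue_seq scale A E"
    and dual_eigenvalues: "\<theta>s = pos_fin_dim_vector_space.eigenvalue_seq scale As Es"
    and split: "\<zeta> = pos_fin_dim_vector_space.split_seq scale d A E As Es"
    and split_down: "\<zeta>d = pos_fin_dim_vector_space.split_seq scale d A E As (\<lambda>i. Es (d - i))"
    and split_Down: "\<zeta>D = pos_fin_dim_vector_space.split_seq scale d A (\<lambda>i. E (d - i)) As Es"
    and split_down_Down: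
      "\<zeta>dD = pos_fin_dim_vector_space.split_seq scale d A (\<lambda>i. E (d - i)) As (\<lambda>i. Es (d - i))"
    and q_nonzero: "q \<noteq> 0"
    and q_ratio: "d \<ge> 3 \<Longrightarrow> q + inverse q + 1 = to_ac (common_ratio d \<theta> \<theta>s)"
  shows "(\<forall>i\<le>d.
      \<zeta>d i / (\<Prod>j=1..i. \<theta> 0 - \<theta> j) =
        (\<Sum>h=0..i. qbracket q h (i - h) (d - i) * poly (eta_poly d \<theta>s (i - h)) (\<theta>s 0) * \<zeta> h
           / (\<Prod>j=1..h. \<theta> 0 - \<theta> j)) \<and>
      \<zeta> i / (\<Prod>j=1..i. \<theta> 0 - \<theta> j) =
        (\<Sum>h=0..i. qbracket q h (i - h) (d - i) * poly (tau_poly \<theta>s (i - h)) (\<theta>s d) * \<zeta>d h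
           / (\<Prod>j=1..h. \<theta> 0 - \<theta> j))) \<and>
    (\<forall>i\<le>d.
      \<zeta>D i / (\<Prod>j=1..i. \<theta>s 0 - \<theta>s j) =
        (\<Sum>h=0..i. qbracket q h (i - h) (d - i) * poly (eta_poly d \<theta> (i - h)) (\<theta> 0) * \<zeta> h
           / (\<Prod>j=1..h. \<theta>s 0 - \<theta>s j)) \<and>
      \<zeta> i / (\<Prod>j=1..i. \<theta>s 0 - \<theta>s j) =
        (\<Sum>h=0..i. qbracket q h (i - h) (d - i) * poly (tau_poly \<theta> (i - h)) (\<theta> d) * \<zeta>D h
           / (\<Prod>j=1..h. \<theta>s 0 - \<theta>s j))) \<and>
    (\<forall>i\<le>d.
      \<zeta>dD i / (\<Prod>j=1..i. \<theta>s d - \<theta>s (d - j)) =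
        (\<Sum>h=0..i. qbracket q h (i - h) (d - i) * poly (eta_poly d \<theta> (i - h)) (\<theta> 0) * \<zeta>d h
           / (\<Prod>j=1..h. \<theta>s d - \<theta>s (d - j))) \<and>
      \<zeta>d i / (\<Prod>j=1..i. \<theta>s d - \<theta>s (d - j)) =
        (\<Sum>h=0..i. qbracket q h (i - h) (d - i) * poly (tau_poly \<theta> (i - h)) (\<theta> d) * \<zeta>dD h
           / (\<Prod>j=1..h. \<theta>s d - \<theta>s (d - j)))) \<and>
    (\<forall>i\<le>d.
      \<zeta>dD i / (\<Prod>j=1..i. \<theta> d - \<theta> (d - j)) =
        (\<Sum>h=0..i. qbracket q h (i - h) (d - i) * poly (eta_poly d \<theta>s (i - h)) (\<theta>s 0) * \<zeta>D h
           / (\<Prod>j=1..h. \<theta> d - \<theta> (d - j))) \<and>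
      \<zeta>D i / (\<Prod>j=1..i. \<theta> d - \<theta> (d - j)) =
        (\<Sum>h=0..i. qbracket q h (i - h) (d - i) * poly (tau_poly \<theta>s (i - h)) (\<theta>s d) * \<zeta>dD h
           / (\<Prod>j=1..h. \<theta> d - \<theta> (d - j))))"
proof -
  interpret pos_fin_dim_vector_space scale Basis by (rule space)
  have sys: "tridiagonal_system d A E As Es" and dim: "dim (range (E 0)) = 1"
    using sharp by (simp_all add: sharp_tridiagonal_system_def)
  interpret td_system scale Basis d A E As Es by (rule td_system_if_tridiagonal_system[OF sys])
  interpret Down: td_system scale Basis d A "\<lambda>i. E (d - i)" As Es
    by (rule td_system_reverse) unfold_locales
  interpret down: td_system scale Basis d A E As "\<lambda>i. Es (d - i)"
    by (rule td_system_dual, rule td_system_reverse, rule td_system_dual) unfold_locales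
  \<comment> \<open>Serves to pass from the line \<open>range (Es 0)\<close> to the range of
    \<open>E d\<close>.\<close>
  interpret Down_dual: td_system scale Basis d As Es A "\<lambda>i. E (d - i)"
    by (rule td_system_dual) unfold_locales
  have th: "th = \<theta>" "star.th = \<theta>s"
    by (simp_all add: eigenvalues dual_eigenvalues)
  have rth: "Down.th = (\<lambda>i. \<theta> (d - i))" "down.star.th = (\<lambda>i. \<theta>s (d - i))"
    unfolding th[symmetric] by (rule eigenvalue_seq_comp[OF space])+
  have line_E: "line (range (E 0))" by (rule line_if_dim_1[OF subspace_range_E dim]) simp
  have line_Es: "line (range (Es 0))" by (rule line_range_Es[OF line_E])
  have line_Esd: "line (range (Es (d - 0)))" by (rule down.line_range_Es[OF line_E])
  have line_Ed: "line (range (E (d - 0)))" by (rule Down_dual.line_range_Es[OF line_Es])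
  have br: "bracket_recurrence d \<theta> (qbracket q)" "bracket_recurrence d (\<lambda>i. \<theta> (d - i)) (qbracket q)"
      "bracket_recurrence d \<theta>s (qbracket q)" "bracket_recurrence d (\<lambda>i. \<theta>s (d - i)) (qbracket q)"
    by (rule qbracket_recurrences[unfolded th]; fact q_nonzero q_ratio)+
  note split_defs = split split_down split_Down split_down_Down
  note down_transition = split_seq_down_transition[OF line_E br(3,4)[folded th], unfolded th,
      folded split_defs]
  note Down_transition = split_seq_Down_transition[OF line_Es br(1,2)[folded th], unfolded th,
      folded split_defs]
  \<comment> \<open>The third pair of formulas is the second pair for the system with
    \<open>Es\<close> reversed; the fourth is the first pair for the system with \<open>E\<close>
    reversed.\<close>
  note down_Down_transition = down.split_seq_Down_transition[OF line_Esd br(1,2)[folded th],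
      unfolded th rth, folded split_defs]
  note Down_down_transition = Down.split_seq_down_transition[OF line_Ed br(3,4)[folded th],
      unfolded th rth, folded split_defs]
  show ?thesis
    by (intro conjI[OF _ conjI[OF _ conjI]] allI impI)
      (erule down_transition, erule Down_transition,
       erule down_Down_transition[unfolded diff_zero], erule Down_down_transition[unfolded diff_zero])
qed

end
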